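(* Let $c>0$ and let $(S_t,V_t)$ be a sub-$\psi_{G,c}$ process in $\mathbb{R}^d$, where $\psi_{G,c}(\lambda)=\frac{\lambda^2}{2(1-c\lambda)}$ on $[0,1/c)$. Suppose $U_0$ is a fixed positive definite matrix such that $V_t+U_0\succeq I_d$ for all $t\ge1$, and let $\upsilon=\gamma_{\min}(U_0)$. Fix $\delta\in(0,1/e]$ and let $\xi(x)=\frac{2}{c+\sqrt{c^2+2x}}$. Then, with probability at least $1-\delta$, for all stopping times $\tau$, $$\|S_\tau\|_{(V_\tau+U_0)^{-1}}\le\frac{cD_\tau+1.51\sqrt{D_\tau}+\xi(c)\max\left\{\frac{1}{\xi(\upsilon)\upsilon},\sqrt{\frac{D_\tau}{2}}\right\}}{H_{c,\tau}},$$ where $$D_\tau=\frac12\log\left(\frac{\det(V_\tau+U_0)}{\det U_0}\right)+1.5+2\log\big(\log_2(\det(V_\tau+U_0))+1\big)+\log(1/\delta)$$ and $$H_{c,\tau}=\max\left\{0,\ \sqrt{\frac{\sqrt{c^2+2c}-c}{3+c}}-\sqrt{\frac{\gamma_{\max}(U_0)}{\gamma_{\min}(V_\tau+U_0)}\,\xi(c)}\right\}.$$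
   Context: Fix a filtered probability space $(\Omega,\mathcal{F}=(\mathcal{F}_t)_{t\ge0},P)$ in discrete time ($t\in\{0,1,2,\dots\}$); $\langle\cdot,\cdot\rangle$ is the dot product on $\mathbb{R}^d$, $\mathbb{S}^{d-1}$ the unit sphere, $\gamma_{\min}(M)$ and $\gamma_{\max}(M)$ the smallest and largest eigenvalue of a symmetric matrix $M$, $\succeq$ the Loewner order, and $\|v\|_A^2=\langle v,Av\rangle$ for a positive semidefinite matrix $A$. Sub-$\psi$ process, for $\psi:[0,\lambda_{\max})\to\mathbb{R}_{\ge0}$: let $(S_t)$ be an $\mathbb{R}^d$-valued process and $(V_t)$ an $\mathbb{R}^{d\times d}$-valued process with $V_t\succ0$, both adapted to $\mathcal{F}$. $(S_t,V_t)$ is a sub-$\psi$ process if for all $\theta\in\mathbb{S}^{d-1}$, all $\lambda\in[0,\lambda_{\max})$ and all $t\ge0$, $$\exp\{\lambda\langle\theta,S_t\rangle-\psi(\lambda)\langle\theta,V_t\theta\rangle\}\le L_t^\lambda(\theta),$$ where $(L_t^\lambda(\theta))_{t\ge0}$ is a nonnegative supermartingale adapted to $\mathcal{F}$ with $L_0^\lambda(\theta)\le1$. For $\psi_{G,c}$ with $c>0$, $\lambda_{\max}=1/c$. "With probability at least $1-\delta$, for all stopping times $\tau$, [bound at $\tau$]" is equivalent to $P(\forall t\ge1:\text{[bound at }t])\ge1-\delta$. When $H_{c,\tau}=0$ the right-hand side is read as $+\infty$. *)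

theory Defs
  imports "HOL-Probability.Probability"
begin

section \<open>Symmetric matrices\<close>

definition pos_def :: "real^'d^'d \<Rightarrow> bool" where
  "pos_def A \<longleftrightarrow> transpose A = A \<and> (\<forall>x. x \<noteq> 0 \<longrightarrow> 0 < x \<bullet> (A *v x))"

definition pos_semidef :: "real^'d^'d \<Rightarrow> bool" where
  "pos_semidef A \<longleftrightarrow> transpose A = A \<and> (\<forall>x. 0 \<le> x \<bullet> (A *v x))"

definition loewner_ge :: "real^'d^'d \<Rightarrow> real^'d^'d \<Rightarrow> bool" where
  "loewner_ge A B \<longleftrightarrow> pos_semidef (A - B)"

definition eigenvalues :: "real^'d^'d \<Rightarrow> real set" where
  "eigenvalues A = {\<mu>. \<exists>v. v \<noteq> 0 \<and> A *v v = \<mu> *\<^sub>R v}"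

text \<open>Only used for symmetric matrices, whose set of real eigenvalues is finite and nonempty;
  otherwise \<^const>\<open>Min\<close> and \<^const>\<open>Max\<close> carry no information.\<close>

definition gamma_min :: "real^'d^'d \<Rightarrow> real" where
  "gamma_min A = Min (eigenvalues A)"

definition gamma_max :: "real^'d^'d \<Rightarrow> real" where
  "gamma_max A = Max (eigenvalues A)"

definition mat_norm :: "real^'d^'d \<Rightarrow> real^'d \<Rightarrow> real" where
  "mat_norm A v = sqrt (v \<bullet> (A *v v))"

section \<open>Discrete-time processes\<close>

locale filtered_prob_space = prob_space M + filtration "space M" F
  for M :: "'a measure" and F :: "nat \<Rightarrow> 'a measure" +
  assumes subalgebra_F: "\<And>t. subalgebra M (F t)"

definition adapted :: "(nat \<Rightarrow> 'a measure) \<Rightarrow> (nat \<Rightarrow> 'a \<Rightarrow> 'b::topological_space) \<Rightarrow> bool" where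
  "adapted F X \<longleftrightarrow> (\<forall>t. X t \<in> borel_measurable (F t))"

definition supermartingale ::
    "'a measure \<Rightarrow> (nat \<Rightarrow> 'a measure) \<Rightarrow> (nat \<Rightarrow> 'a \<Rightarrow> real) \<Rightarrow> bool" where
  "supermartingale M F X \<longleftrightarrow>
     adapted F X \<and> (\<forall>t. integrable M (X t)) \<and>
     (\<forall>s t. s \<le> t \<longrightarrow> (AE \<omega> in M. real_cond_exp M (F s) (X t) \<omega> \<le> X s \<omega>))"

text \<open>Inequalities between random variables are understood almost surely, with an exceptional
  set that may depend on \<open>\<theta>\<close>, \<open>\<lambda>\<close> and \<open>t\<close>.\<close>

definition sub_psi_process ::
    "'a measure \<Rightarrow> (nat \<Rightarrow> 'a measure) \<Rightarrow> real \<Rightarrow> (real \<Rightarrow> real) \<Rightarrow>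
     (nat \<Rightarrow> 'a \<Rightarrow> real^'d) \<Rightarrow> (nat \<Rightarrow> 'a \<Rightarrow> real^'d^'d) \<Rightarrow> bool" where
  "sub_psi_process M F lmax \<psi> S V \<longleftrightarrow>
     adapted F S \<and> adapted F V \<and> (\<forall>t. \<forall>\<omega>\<in>space M. pos_def (V t \<omega>)) \<and>
     (\<forall>\<theta>. norm \<theta> = 1 \<longrightarrow> (\<forall>l\<in>{0..<lmax}. \<exists>L.
        supermartingale M F L \<and>
        (\<forall>t. AE \<omega> in M. 0 \<le> L t \<omega>) \<and>
        (AE \<omega> in M. L 0 \<omega> \<le> 1) \<and>
        (\<forall>t. AE \<omega> in M.
           exp (l * (\<theta> \<bullet> S t \<omega>) - \<psi> l * (\<theta> \<bullet> (V t \<omega> *v \<theta>))) \<le> L t \<omega>)))"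

definition psi_G :: "real \<Rightarrow> real \<Rightarrow> real" where
  "psi_G c l = l^2 / (2 * (1 - c * l))"

section \<open>The bound\<close>

definition xi :: "real \<Rightarrow> real \<Rightarrow> real" where
  "xi c x = 2 / (c + sqrt (c^2 + 2 * x))"

definition D_term :: "real \<Rightarrow> real^'d^'d \<Rightarrow> real^'d^'d \<Rightarrow> real" where
  "D_term \<delta> U0 V =
     1/2 * ln (det (V + U0) / det U0) + 1.5 + 2 * ln (log 2 (det (V + U0)) + 1) + ln (1 / \<delta>)"

definition H_term :: "real \<Rightarrow> real^'d^'d \<Rightarrow> real^'d^'d \<Rightarrow> real" where
  "H_term c U0 V =
     max 0 (sqrt ((sqrt (c^2 + 2 * c) - c) / (3 + c))
            - sqrt (gamma_max U0 / gamma_min (V + U0) * xi c c))"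

definition bound_rhs :: "real \<Rightarrow> real \<Rightarrow> real^'d^'d \<Rightarrow> real^'d^'d \<Rightarrow> ereal" where
  "bound_rhs c \<delta> U0 V =
     (let D = D_term \<delta> U0 V; H = H_term c U0 V; v = gamma_min U0 in
      if H = 0 then \<infinity>
      else ereal ((c * D + 1.51 * sqrt D + xi c c * max (1 / (xi c v * v)) (sqrt (D / 2))) / H))"

text \<open>Quantifying over all stopping times inside the event amounts to quantifying over all
  times \<open>t \<ge> 1\<close>. Possibly infinite stopping times would add nothing:
  where such a \<open>\<tau>\<close> is finite it agrees with \<open>min \<tau> n\<close> for large \<open>n\<close>.\<close>

lemma stopping_time_event_eq:
  fixes F :: "nat \<Rightarrow> 'a measure"
  shows "{\<omega>\<in>space M. \<forall>\<tau>. stopping_time F \<tau> \<longrightarrow> 1 \<le> \<tau> \<omega> \<longrightarrow> Q (\<tau> \<omega>) \<omega>} =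
         {\<omega>\<in>space M. \<forall>t\<ge>1. Q t \<omega>}"
  using stopping_time_const[of F] by blast

end

theory Submission
  imports Defs
begin

text \<open>Write \<open>W = V + U0\<close>. For a fixed radius \<open>r < 1/c\<close> put \<open>a = 1 / (1 - c r)\<close>, so that
  \<open>\<psi>\<^sub>G \<lambda> \<le> a \<lambda>\<^sup>2 / 2\<close> for \<open>\<lambda> \<le> r\<close>, and mix \<open>exp (\<langle>x, S\<rangle> - a/2 \<langle>x, V x\<rangle>)\<close> over the centred Gaussian
  with precision \<open>a U0\<close> truncated to the ball of radius \<open>r\<close>. By Ville's inequality the mixture
  rarely ever becomes large. If \<open>T\<^sup>t W T = U0\<close>, then \<open>T\<close> has operator norm at most
  \<open>\<rho> = sqrt (\<gamma>\<^sub>m\<^sub>a\<^sub>x U0 / \<gamma>\<^sub>m\<^sub>i\<^sub>n W)\<close>, so for \<open>norm m \<le> (1 - \<rho>) r\<close> the substitution \<open>x \<mapsto> m + T x\<close>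
  stays in the ball and, linear terms only helping by symmetry, bounds the mixture below by
  \<open>sqrt (det U0 / det W) exp (\<langle>m, S\<rangle> - a/2 \<langle>m, W m\<rangle>)\<close>; no normalization constant of the truncation
  is lost. Taking \<open>m\<close> parallel to \<open>W\<^sup>-\<^sup>1 S\<close> with \<open>W\<close>-norm \<open>(1 - \<rho>) r\<close> gives the bound for radii \<open>r\<close> adapted to
  \<open>D\<close>, and a union bound over the radii adapted to the dyadic values of \<open>det W\<close>, with weights
  \<open>exp (- 1.5) / (j + 1)\<^sup>2\<close>, makes \<open>r\<close> data dependent. Finally \<open>H \<le> (1 - \<rho>) / 2\<close> whenever \<open>H > 0\<close>.\<close>

section \<open>Spectral theory of real symmetric matrices\<close>

lemma inner_matrix_symmetric:
  fixes A :: "real^'d^'d"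
  assumes "transpose A = A"
  shows "x \<bullet> (A *v y) = (A *v x) \<bullet> y"
  using assms by (metis dot_lmul_matrix transpose_matrix_vector)

lemma quadratic_form_add:
  fixes A :: "real^'d^'d"
  assumes "transpose A = A"
  shows "(x + y) \<bullet> (A *v (x + y)) = x \<bullet> (A *v x) + 2 * (y \<bullet> (A *v x)) + y \<bullet> (A *v y)"
  using inner_matrix_symmetric[OF assms, of x y]
  by (simp add: matrix_vector_right_distrib inner_simps inner_commute)

lemma quadratic_form_scaleR:
  fixes A :: "real^'d^'d"
  shows "(k *\<^sub>R x) \<bullet> (A *v (k *\<^sub>R x)) = k\<^sup>2 * (x \<bullet> (A *v x))"
  by (simp add: matrix_vector_mult_scaleR power2_eq_square)

text \<open>A minimizer of the Rayleigh quotient on the unit sphere of \<open>S\<close> is an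
  eigenvector: its residual stays in \<open>S\<close> by invariance, and moving against a nonzero
  residual would lower the quotient. Working inside an invariant subspace lets the diagonalization
  split off one eigenvector after another.\<close>

lemma symmetric_eigenvector_on_subspace:
  fixes A :: "real^'d^'d"
  assumes sym: "transpose A = A" and S: "subspace S" "S \<noteq> {0}"
    and inv: "\<And>x. x \<in> S \<Longrightarrow> A *v x \<in> S"
  obtains v m where "v \<in> S" "norm v = 1" "A *v v = m *\<^sub>R v"
    "\<And>x. x \<in> S \<Longrightarrow> m * (norm x)\<^sup>2 \<le> x \<bullet> (A *v x)"
proof -
  let ?q = "\<lambda>x. x \<bullet> (A *v x)"
  obtain x0 where x0: "x0 \<in> S" "x0 \<noteq> 0"
    using S subspace_0 by blast
  have "(1 / norm x0) *\<^sub>R x0 \<in> sphere 0 1 \<inter> S"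
    using x0 S by (auto simp: subspace_scale)
  moreover have "compact (sphere 0 1 \<inter> S)"
    using S closed_subspace by (intro compact_Int_closed) auto
  moreover have "continuous_on (sphere 0 1 \<inter> S) ?q"
    by (intro continuous_intros matrix_vector_mult_linear_continuous_on)
  ultimately obtain v where v: "v \<in> sphere 0 1 \<inter> S"
    and vmin: "\<And>y. y \<in> sphere 0 1 \<inter> S \<Longrightarrow> ?q v \<le> ?q y"
    using continuous_attains_inf[of "sphere 0 1 \<inter> S" ?q] by blast
  define m where "m = ?q v"
  have nv: "norm v = 1" "v \<in> S" using v by auto
  have le: "m * (norm x)\<^sup>2 \<le> ?q x" if "x \<in> S" for x
  proof (cases "x = 0")
    case False
    have "(1 / norm x) *\<^sub>R x \<in> sphere 0 1 \<inter> S"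
      using False that S by (auto simp: subspace_scale)
    from vmin[OF this] have "m \<le> (1 / norm x)\<^sup>2 * ?q x"
      unfolding m_def quadratic_form_scaleR .
    then show ?thesis using False by (simp add: field_simps power_divide)
  qed simp
  define w where "w = A *v v - m *\<^sub>R v"
  have w: "w \<in> S" unfolding w_def using nv S inv by (intro subspace_diff subspace_scale) auto
  \<comment> \<open>\<open>K\<close> bounds the second-order coefficient, and the added
    \<open>1\<close> keeps it positive. The \<open>t\<close> below minimizes
    \<open>2 * t * (norm w)\<^sup>2 + t\<^sup>2 * K\<close>; the minimum
    \<open>- ((norm w) ^ 4 / K)\<close> would be negative for nonzero \<open>w\<close>.\<close>
  define K where "K = \<bar>?q w - m * (norm w)\<^sup>2\<bar> + 1"
  have K: "K > 0" unfolding K_def by simp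
  define t where "t = - (norm w)\<^sup>2 / K"
  have "v + t *\<^sub>R w \<in> S" using nv w S by (intro subspace_add subspace_scale) auto
  from le[OF this] have "m * (norm (v + t *\<^sub>R w))\<^sup>2 \<le> ?q (v + t *\<^sub>R w)" .
  also have "?q (v + t *\<^sub>R w) = m + 2 * t * (w \<bullet> (A *v v)) + t\<^sup>2 * ?q w"
    unfolding quadratic_form_add[OF sym] quadratic_form_scaleR m_def by simp
  also have "(norm (v + t *\<^sub>R w))\<^sup>2 = 1 + 2 * t * (w \<bullet> v) + t\<^sup>2 * (norm w)\<^sup>2"
    using nv unfolding power2_norm_eq_inner
    by (simp add: inner_simps power2_eq_square inner_commute norm_eq_1)
  finally have *: "m * (1 + 2 * t * (w \<bullet> v) + t\<^sup>2 * (norm w)\<^sup>2)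
      \<le> m + 2 * t * (w \<bullet> (A *v v)) + t\<^sup>2 * ?q w" .
  have "w \<bullet> w = w \<bullet> (A *v v) - m * (w \<bullet> v)"
    by (subst (2) w_def) (simp add: inner_simps)
  then have "t * (w \<bullet> w) = t * (w \<bullet> (A *v v)) - t * (m * (w \<bullet> v))"
    by (simp add: right_diff_distrib)
  with * have "0 \<le> 2 * t * (w \<bullet> w) + t\<^sup>2 * (?q w - m * (norm w)\<^sup>2)"
    by (simp add: algebra_simps)
  also have "\<dots> \<le> 2 * t * (norm w)\<^sup>2 + t\<^sup>2 * K"
    using mult_left_mono[of "?q w - m * (norm w)\<^sup>2" K "t\<^sup>2"]
    by (simp add: power2_norm_eq_inner K_def)
  also have "\<dots> = - ((norm w) ^ 4 / K)"
    unfolding t_def using K by (simp add: field_simps power2_eq_square power4_eq_xxxx)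
  finally have "(norm w) ^ 4 \<le> 0" using K by (simp add: field_simps)
  then have "w = 0" by simp
  then have "A *v v = m *\<^sub>R v" unfolding w_def by simp
  with nv le show ?thesis using that by blast
qed

lemma symmetric_eigenvectors_orthogonal:
  fixes A :: "real^'d^'d"
  assumes "transpose A = A" "A *v u = a *\<^sub>R u" "A *v v = b *\<^sub>R v" "a \<noteq> b"
  shows "u \<bullet> v = 0"
  using inner_matrix_symmetric[OF assms(1), of u v] assms(2-4) by simp

text \<open>Eigenvectors for distinct eigenvalues are orthogonal, hence independent. Finiteness is
  what gives \<open>Min\<close> and \<open>Max\<close> in \<open>gamma_min\<close> and
  \<open>gamma_max\<close> their meaning.\<close>

lemma finite_eigenvalues_symmetric:
  fixes A :: "real^'d^'d"
  assumes sym: "transpose A = A"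
  shows "finite (eigenvalues A)"
proof -
  obtain f where f: "\<And>a. a \<in> eigenvalues A \<Longrightarrow> f a \<noteq> 0 \<and> A *v f a = a *\<^sub>R f a"
    unfolding eigenvalues_def by (atomize_elim, rule choice) auto
  have orth: "f a \<bullet> f b = 0" if "a \<in> eigenvalues A" "b \<in> eigenvalues A" "a \<noteq> b" for a b
    using f that symmetric_eigenvectors_orthogonal[OF sym] by blast
  have "pairwise orthogonal (f ` eigenvalues A)"
    using orth by (auto simp: pairwise_def orthogonal_def)
  then have "independent (f ` eigenvalues A)"
    using f by (intro pairwise_orthogonal_independent) force+
  then have "finite (f ` eigenvalues A)" by (rule independent_imp_finite)
  moreover have "inj_on f (eigenvalues A)"
    by (rule inj_onI) (metis f inner_eq_zero_iff orth)
  ultimately show ?thesis by (simp add: finite_image_iff)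
qed

text \<open>The Rayleigh minimum over the whole space is an eigenvalue and lies below every other
  one, so it is \<open>gamma_min A\<close>.\<close>

lemma
  fixes A :: "real^'d^'d"
  assumes sym: "transpose A = A"
  shows gamma_min_in_eigenvalues: "gamma_min A \<in> eigenvalues A"
    and gamma_min_quadratic_form: "gamma_min A * (norm x)\<^sup>2 \<le> x \<bullet> (A *v x)"
proof -
  have ne: "(UNIV :: (real^'d) set) \<noteq> {0}"
    by (metis UNIV_I singletonD zero_neq_one)
  obtain v m where v: "norm v = 1" "A *v v = m *\<^sub>R v"
    and m: "\<And>x. m * (norm x)\<^sup>2 \<le> x \<bullet> (A *v x)"
    using symmetric_eigenvector_on_subspace[OF sym subspace_UNIV ne] by auto
  have "m \<in> eigenvalues A" unfolding eigenvalues_def using v by (auto intro!: exI[of _ v])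
  moreover have "m \<le> \<mu>" if \<mu>: "\<mu> \<in> eigenvalues A" for \<mu>
  proof -
    obtain u where u: "u \<noteq> 0" "A *v u = \<mu> *\<^sub>R u"
      using \<mu> unfolding eigenvalues_def by blast
    have "m * (norm u)\<^sup>2 \<le> \<mu> * (norm u)\<^sup>2"
      using m[of u] u by (simp add: power2_norm_eq_inner)
    then show ?thesis using u by simp
  qed
  ultimately have "gamma_min A = m"
    unfolding gamma_min_def using finite_eigenvalues_symmetric[OF sym] by (intro Min_eqI) auto
  with \<open>m \<in> eigenvalues A\<close> m show "gamma_min A \<in> eigenvalues A" "gamma_min A * (norm x)\<^sup>2 \<le> x \<bullet> (A *v x)"
    by auto
qed

text \<open>Trades the eigenvalue for a family of quadratic inequalities, the form used for Loewner
  bounds and for measurability.\<close>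

lemma le_gamma_min_iff:
  fixes A :: "real^'d^'d"
  assumes sym: "transpose A = A"
  shows "a \<le> gamma_min A \<longleftrightarrow> (\<forall>x. a * (norm x)\<^sup>2 \<le> x \<bullet> (A *v x))"
proof
  assume "a \<le> gamma_min A"
  then show "\<forall>x. a * (norm x)\<^sup>2 \<le> x \<bullet> (A *v x)"
    using gamma_min_quadratic_form[OF sym] by (meson mult_right_mono order_trans zero_le_power2)
next
  assume a: "\<forall>x. a * (norm x)\<^sup>2 \<le> x \<bullet> (A *v x)"
  obtain v where v: "v \<noteq> 0" "A *v v = gamma_min A *\<^sub>R v"
    using gamma_min_in_eigenvalues[OF sym] unfolding eigenvalues_def by blast
  then have "a * (norm v)\<^sup>2 \<le> gamma_min A * (norm v)\<^sup>2"
    using a[rule_format, of v] by (simp add: power2_norm_eq_inner)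
  then show "a \<le> gamma_min A" using v by simp
qed

lemma gamma_min_pos:
  assumes "pos_def A"
  shows "gamma_min A > 0"
proof -
  have sym: "transpose A = A" using assms by (simp add: pos_def_def)
  obtain v where v: "v \<noteq> 0" "A *v v = gamma_min A *\<^sub>R v"
    using gamma_min_in_eigenvalues[OF sym] unfolding eigenvalues_def by blast
  have "0 < v \<bullet> (A *v v)" using assms v unfolding pos_def_def by blast
  moreover have "0 < v \<bullet> v" using v by simp
  ultimately show ?thesis using v(2) zero_less_mult_pos2 by fastforce
qed

text \<open>Apply the lower bound to \<open>- A\<close>: the number \<open>- gamma_min (- A)\<close>
  is an eigenvalue of \<open>A\<close>, hence at most the maximum.\<close>

lemma gamma_max_quadratic_form:
  fixes A :: "real^'d^'d"
  assumes sym: "transpose A = A"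
  shows "x \<bullet> (A *v x) \<le> gamma_max A * (norm x)\<^sup>2"
proof -
  have neg: "(- A) *v x = - (A *v x)" for x
    by (metis diff_0 matrix_vector_mult_0 matrix_vector_mult_diff_rdistrib)
  have symn: "transpose (- A) = - A"
    using sym by (simp add: transpose_def vec_eq_iff)
  have "- gamma_min (- A) \<in> eigenvalues A"
    using gamma_min_in_eigenvalues[OF symn] unfolding eigenvalues_def by (auto simp: neg) (metis minus_minus scaleR_minus_left)
  then have "- gamma_min (- A) \<le> gamma_max A"
    unfolding gamma_max_def using finite_eigenvalues_symmetric[OF sym] by simp
  moreover have "x \<bullet> (A *v x) \<le> - gamma_min (- A) * (norm x)\<^sup>2"
    using gamma_min_quadratic_form[OF symn, of x] by (simp add: neg)
  ultimately show ?thesis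
    by (meson mult_right_mono order_trans zero_le_power2)
qed

text \<open>An orthonormal set \<open>B\<close> of eigenvectors of largest size exists because
  independence bounds its cardinality. Its orthogonal complement is invariant under
  \<open>A\<close>, so a nonzero complement would supply one more eigenvector. Hence
  \<open>B\<close> is an orthonormal basis, and its members are the columns of
  \<open>Q\<close>.\<close>

lemma symmetric_diagonalization:
  fixes A :: "real^'d^'d"
  assumes sym: "transpose A = A"
  obtains Q :: "real^'d^'d" and d :: "'d \<Rightarrow> real"
  where "orthogonal_matrix Q" "transpose Q ** A ** Q = (\<chi> i j. if i = j then d i else 0)"
proof -
  define P where "P B \<longleftrightarrow> (\<forall>b\<in>B. norm b = 1 \<and> (\<exists>m. A *v b = m *\<^sub>R b)) \<and> pairwise orthogonal B"
    for B :: "(real^'d) set"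
  have indep: "independent B" if "P B" for B
    using that unfolding P_def by (intro pairwise_orthogonal_independent) force+
  have "card B < Suc CARD('d)" if "P B" for B
    using independent_card_le[OF indep[OF that]] by simp
  moreover have "P {}" unfolding P_def by simp
  ultimately obtain B where PB: "P B" and max: "\<And>C. P C \<Longrightarrow> card C \<le> card B"
    using ex_has_greatest_nat[of P "{}" card "Suc CARD('d)"] by blast
  define S where "S = {x. \<forall>b\<in>B. b \<bullet> x = 0}"
  have sub: "subspace S" unfolding S_def subspace_def by (auto simp: inner_simps)
  have fin: "finite B" using indep[OF PB] by (rule independent_imp_finite)
  have "S = {0}"
  proof (rule ccontr)
    assume ne: "S \<noteq> {0}"
    have inv: "A *v x \<in> S" if "x \<in> S" for x
      unfolding S_def
    proof safe
      fix b assume b: "b \<in> B"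
      then obtain m where "A *v b = m *\<^sub>R b" using PB unfolding P_def by blast
      then show "b \<bullet> (A *v x) = 0"
        using inner_matrix_symmetric[OF sym, of b x] b that unfolding S_def by simp
    qed
    obtain v m where v: "v \<in> S" "norm v = 1" "A *v v = m *\<^sub>R v"
      using symmetric_eigenvector_on_subspace[OF sym sub ne inv] by metis
    have "v \<notin> B" using v unfolding S_def by force
    moreover have "P (insert v B)"
      using PB v unfolding P_def S_def pairwise_insert
      by (auto simp: orthogonal_def inner_commute)
    ultimately show False using max[of "insert v B"] fin by simp
  qed
  have "UNIV \<subseteq> span B"
  proof
    fix x
    obtain y z where yz: "y \<in> span B" "\<And>w. w \<in> span B \<Longrightarrow> orthogonal z w" "x = y + z"
      using orthogonal_subspace_decomp_exists[of B x] by metis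
    have "z \<in> S" unfolding S_def using yz(2)
      by (auto simp: orthogonal_def inner_commute span_base)
    then show "x \<in> span B" using yz \<open>S = {0}\<close> by simp
  qed
  then have "card B = CARD('d)"
    using basis_card_eq_dim[of B UNIV] indep[OF PB] by simp
  then obtain f where f: "bij_betw f (UNIV :: 'd set) B"
    using finite_same_card_bij[of "UNIV::'d set" B] fin by auto
  have fB: "f i \<in> B" for i using f by (auto simp: bij_betw_def)
  obtain d where d: "\<And>i. A *v f i = d i *\<^sub>R f i"
    using PB fB unfolding P_def by (atomize_elim, intro choice) blast
  have orth: "f i \<bullet> f j = (if i = j then 1 else 0)" for i j
    using PB fB[of i] fB[of j] bij_betw_imp_inj_on[OF f] unfolding P_def pairwise_def orthogonal_def
    by (cases "i = j") (auto simp: norm_eq_1 inj_eq)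
  define Q :: "real^'d^'d" where "Q = transpose (\<chi> i. f i)"
  have Qe: "(transpose Q ** X ** Q) $ i $ j = f i \<bullet> (X *v f j)" for X i j
    unfolding matrix_mul_assoc[symmetric]
    by (simp del: matrix_mul_assoc add: Q_def matrix_matrix_mult_def transpose_def
        inner_vec_def matrix_vector_mult_def)
  show ?thesis
  proof
    show "orthogonal_matrix Q"
      unfolding orthogonal_matrix using Qe[of "mat 1", simplified] orth
      by (simp add: vec_eq_iff mat_def)
    show "transpose Q ** A ** Q = (\<chi> i j. if i = j then d i else 0)"
      using Qe[of A] d orth by (simp add: vec_eq_iff)
  qed
qed

section \<open>Linear changes of variables in Lebesgue integrals\<close>

lemma nn_integral_lborel_translation:
  fixes f :: "'b::euclidean_space \<Rightarrow> ennreal"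
  assumes [measurable]: "f \<in> borel_measurable borel"
  shows "(\<integral>\<^sup>+x. f (x + c) \<partial>lborel) = (\<integral>\<^sup>+x. f x \<partial>lborel)"
proof -
  have "(\<integral>\<^sup>+x. f x \<partial>lborel) = (\<integral>\<^sup>+x. f x \<partial>distr lborel borel ((+) c))"
    by (simp only: lborel_distr_plus)
  also have "\<dots> = (\<integral>\<^sup>+x. f (x + c) \<partial>lborel)"
    by (subst nn_integral_distr) (auto simp: add.commute)
  finally show ?thesis ..
qed

text \<open>The uniqueness argument for Haar measure: the unit ball \<open>B\<close> is invariant under \<open>q\<close>, and
  translation invariance and Fubini give
  \<open>|B| * \<integral> f (q y) = \<integral>\<integral> [x \<in> B] f (q y + x) = \<integral>\<integral> [x - q y \<in> B] f x = |B| * \<integral> f\<close>.\<close>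

lemma nn_integral_lborel_orthogonal_transformation:
  fixes f :: "'b::euclidean_space \<Rightarrow> ennreal" and q :: "'b \<Rightarrow> 'b"
  assumes q: "orthogonal_transformation q" and f[measurable]: "f \<in> borel_measurable borel"
  shows "(\<integral>\<^sup>+x. f (q x) \<partial>lborel) = (\<integral>\<^sup>+x. f x \<partial>lborel)"
proof -
  define g :: "'b \<Rightarrow> ennreal" where "g = indicator (ball 0 1)"
  have g[measurable]: "g \<in> borel_measurable borel" unfolding g_def by (intro borel_measurable_indicator) simp
  have lin: "linear q" using q by (simp add: orthogonal_transformation_def)
  have q_meas[measurable]: "q \<in> borel_measurable borel"
    using lin by (intro borel_measurable_continuous_onI linear_continuous_on linear_conv_bounded_linear[THEN iffD1])
  have g_q: "g (- q y) = g y" for y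
    using q by (simp add: g_def indicator_def orthogonal_transformation_norm)
  \<comment> \<open>Writing a shift \<open>x\<close> as \<open>q (p x)\<close> moves it inside
    \<open>q\<close> by linearity, where translation invariance removes it.\<close>
  obtain p where p: "\<And>x. q (p x) = x"
    using orthogonal_transformation_surj[OF q] by (metis surj_def)
  define G where "G = (\<integral>\<^sup>+x. g x \<partial>lborel)"
  have G: "G = emeasure lborel (ball (0::'b) 1)"
    unfolding G_def g_def by simp
  have "G * (\<integral>\<^sup>+y. f (q y) \<partial>lborel) = (\<integral>\<^sup>+x. g x * (\<integral>\<^sup>+y. f (q y) \<partial>lborel) \<partial>lborel)"
    unfolding G_def by (subst nn_integral_multc) auto
  also have "\<dots> = (\<integral>\<^sup>+x. (\<integral>\<^sup>+y. g x * f (q y + x) \<partial>lborel) \<partial>lborel)"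
  proof (rule nn_integral_cong)
    fix x
    have "(\<integral>\<^sup>+y. f (q y + x) \<partial>lborel) = (\<integral>\<^sup>+y. f (q (y + p x)) \<partial>lborel)"
      using lin p by (simp add: linear_add)
    also have "\<dots> = (\<integral>\<^sup>+y. f (q y) \<partial>lborel)"
      by (rule nn_integral_lborel_translation) simp
    finally show "g x * (\<integral>\<^sup>+y. f (q y) \<partial>lborel) = (\<integral>\<^sup>+y. g x * f (q y + x) \<partial>lborel)"
      by (subst nn_integral_cmult) auto
  qed
  also have "\<dots> = (\<integral>\<^sup>+y. (\<integral>\<^sup>+x. g x * f (q y + x) \<partial>lborel) \<partial>lborel)"
    by (rule lborel_pair.Fubini') simp
  also have "\<dots> = (\<integral>\<^sup>+y. (\<integral>\<^sup>+x. g (x - q y) * f x \<partial>lborel) \<partial>lborel)"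
  proof (rule nn_integral_cong)
    fix y
    show "(\<integral>\<^sup>+x. g x * f (q y + x) \<partial>lborel) = (\<integral>\<^sup>+x. g (x - q y) * f x \<partial>lborel)"
      using nn_integral_lborel_translation[of "\<lambda>x. g (x - q y) * f x" "q y"] by (simp add: add.commute)
  qed
  also have "\<dots> = (\<integral>\<^sup>+x. (\<integral>\<^sup>+y. g (x - q y) * f x \<partial>lborel) \<partial>lborel)"
    by (rule lborel_pair.Fubini') simp
  also have "\<dots> = (\<integral>\<^sup>+x. G * f x \<partial>lborel)"
  proof (rule nn_integral_cong)
    fix x
    have "(\<integral>\<^sup>+y. g (x - q y) \<partial>lborel) = (\<integral>\<^sup>+y. g (x - q (y + p x)) \<partial>lborel)"
      by (rule nn_integral_lborel_translation[symmetric]) simp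
    also have "\<dots> = G"
      unfolding G_def using lin p g_q by (simp add: linear_add)
    finally show "(\<integral>\<^sup>+y. g (x - q y) * f x \<partial>lborel) = G * f x"
      by (subst nn_integral_multc) auto
  qed
  also have "\<dots> = G * (\<integral>\<^sup>+x. f x \<partial>lborel)"
    by (subst nn_integral_cmult) auto
  finally show ?thesis
    using G emeasure_lborel_ball_finite[of "0::'b" 1] content_ball_pos[of 1 "0::'b"]
    by (auto simp: ennreal_mult_cancel_left measure_def)
qed

lemma nn_integral_lborel_diagonal:
  fixes f :: "real^'d \<Rightarrow> ennreal" and d :: "'d \<Rightarrow> real"
  assumes d: "\<And>i. d i \<noteq> 0" and f[measurable]: "f \<in> borel_measurable borel"
  shows "(\<integral>\<^sup>+x. f x \<partial>lborel) = ennreal (\<Prod>i\<in>UNIV. \<bar>d i\<bar>) * (\<integral>\<^sup>+x. f (\<chi> i. d i * x $ i) \<partial>lborel)"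
proof -
  \<comment> \<open>\<open>lborel_affine_euclidean\<close> expects scaling factors indexed by basis
    vectors; \<open>c\<close> sends \<open>axis i 1\<close> to \<open>d i\<close>.\<close>
  define c where "c j = (\<Sum>i\<in>UNIV. d i * (j $ i))" for j :: "real^'d"
  have c: "c (axis i 1) = d i" for i
    unfolding c_def axis_def by (simp add: if_distrib cong: if_cong)
  have Basis: "(Basis :: (real^'d) set) = range (\<lambda>i. axis i 1)"
    by (auto simp: Basis_vec_def)
  have inj: "inj (\<lambda>i. axis i 1 :: real^'d)"
    by (auto simp: inj_on_def axis_eq_axis)
  define T where "T x = 0 + (\<Sum>j\<in>Basis. (c j * (x \<bullet> j)) *\<^sub>R j)" for x :: "real^'d"
  have T: "T x = (\<chi> i. d i * x $ i)" for x
    unfolding T_def Basis sum.reindex[OF inj]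
    by (simp add: vec_eq_iff c inner_axis) (simp add: axis_def if_distrib cong: if_cong)
  have [measurable]: "T \<in> borel_measurable borel" unfolding T_def by simp
  have "\<And>j. j \<in> Basis \<Longrightarrow> c j \<noteq> 0" using d c unfolding Basis by auto
  from lborel_affine_euclidean[of c 0, OF this]
  have eq: "lborel = density (distr lborel borel T) (\<lambda>_. (\<Prod>j\<in>Basis. \<bar>c j\<bar>))"
    unfolding T_def by simp
  have P: "(\<Prod>j\<in>Basis. \<bar>c j\<bar>) = (\<Prod>i\<in>UNIV. \<bar>d i\<bar>)"
    unfolding Basis prod.reindex[OF inj] by (simp add: c)
  have "(\<integral>\<^sup>+x. f x \<partial>lborel) = ennreal (\<Prod>j\<in>Basis. \<bar>c j\<bar>) * (\<integral>\<^sup>+x. f (T x) \<partial>lborel)"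
    by (subst eq) (simp add: nn_integral_density nn_integral_distr nn_integral_cmult)
  then show ?thesis unfolding P T .
qed

lemma diagonal_matrix_mult:
  fixes a b :: "'d::finite \<Rightarrow> real"
  shows "(\<chi> i j. if i = j then a i else 0) ** (\<chi> i j. if i = j then b i else 0) =
    (\<chi> i j. if i = j then a i * b i else 0)"
proof -
  have "(\<Sum>k\<in>UNIV. (if i = k then a i else 0) * (if k = j then b k else 0)) =
      (if i = j then a i * b i else 0)" for i j
  proof -
    have "(\<Sum>k\<in>UNIV. (if i = k then a i else 0) * (if k = j then b k else 0)) =
       (\<Sum>k\<in>UNIV. if k = i then (if i = j then a i * b i else 0) else 0)"
      by (rule sum.cong) auto
    then show ?thesis by simp
  qed
  then show ?thesis by (simp add: matrix_matrix_mult_def)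
qed

lemma diagonal_matrix_vector_mult:
  fixes a :: "'d::finite \<Rightarrow> real"
  shows "(\<chi> i j. if i = j then a i else 0) *v x = (\<chi> i. a i * x $ i)"
proof -
  have "(\<Sum>j\<in>UNIV. (if i = j then a i else 0) * x $ j) = a i * x $ i" for i
  proof -
    have "(\<Sum>j\<in>UNIV. (if i = j then a i else 0) * x $ j) = (\<Sum>j\<in>UNIV. if j = i then a i * x $ i else 0)"
      by (rule sum.cong) auto
    then show ?thesis by simp
  qed
  then show ?thesis by (simp add: matrix_vector_mult_def)
qed

lemma quadratic_form_matrix_mult:
  fixes A T :: "real^'d^'d"
  shows "(T *v x) \<bullet> (A *v (T *v x)) = x \<bullet> ((transpose T ** A ** T) *v x)"
  by (metis dot_lmul_matrix matrix_vector_mul_assoc vector_transpose_matrix transpose_transpose)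

text \<open>With \<open>Q\<close> diagonalizing \<open>A\<close>, take \<open>R = Q ** E\<close>,
  where \<open>E\<close> is the inverse square root of the diagonal. The orthogonal factor preserves
  Lebesgue measure, and the diagonal factor contributes the Jacobian
  \<open>1 / sqrt (det A)\<close>.\<close>

lemma
  fixes A :: "real^'d^'d"
  assumes "pos_def A"
  shows det_pos_def: "det A > 0"
    and pos_def_whitening: "\<exists>R R' :: real^'d^'d. R ** R' = mat 1 \<and> R' ** R = mat 1 \<and> transpose R ** A ** R = mat 1 \<and>
      (\<forall>f\<in>borel_measurable borel.
        (\<integral>\<^sup>+x. f x \<partial>lborel) = ennreal (1 / sqrt (det A)) * (\<integral>\<^sup>+x. f (R *v x) \<partial>lborel))"
proof -
  have sym: "transpose A = A" and pos: "\<And>x. x \<noteq> 0 \<Longrightarrow> 0 < x \<bullet> (A *v x)"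
    using assms by (auto simp: pos_def_def)
  obtain Q d where Q: "orthogonal_matrix Q"
    and diag: "transpose Q ** A ** Q = (\<chi> i j. if i = j then d i else 0)"
    using symmetric_diagonalization[OF sym] .
  have QQ: "transpose Q ** Q = mat 1" "Q ** transpose Q = mat 1"
    using Q by (auto simp: orthogonal_matrix_def)
  have d: "d i > 0" for i
  proof -
    have "Q *v axis i 1 \<noteq> 0"
      using QQ by (metis axis_eq_0_iff matrix_vector_mul_assoc matrix_vector_mul_lid matrix_vector_mult_0_right one_neq_zero)
    from pos[OF this] have "0 < axis i 1 \<bullet> ((\<chi> i j. if i = j then d i else 0) *v axis i 1)"
      unfolding quadratic_form_matrix_mult diag .
    then show ?thesis
      by (simp add: matrix_vector_mult_basis column_def inner_axis' del: inner_axis)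
  qed
  have d0: "d i \<noteq> 0" for i using d[of i] by simp
  have "det (transpose Q ** A ** Q) = (\<Prod>i\<in>UNIV. d i)"
    unfolding diag by (subst det_diagonal) auto
  moreover have "det (transpose Q ** A ** Q) = det A"
    using det_orthogonal_matrix[OF Q] by (auto simp: det_mul)
  ultimately have det: "det A = (\<Prod>i\<in>UNIV. d i)" by simp
  then show "det A > 0" using d by (simp add: prod_pos)
  define E :: "real^'d^'d" where "E = (\<chi> i j. if i = j then 1 / sqrt (d i) else 0)"
  define E' :: "real^'d^'d" where "E' = (\<chi> i j. if i = j then sqrt (d i) else 0)"
  have mat1: "mat 1 = (\<chi> i j::'d. if i = j then 1 else (0 :: real))" by (simp add: mat_def)
  have EE: "E ** E' = mat 1" "E' ** E = mat 1"
    unfolding E_def E'_def diagonal_matrix_mult mat1 using d0 by (simp_all add: vec_eq_iff)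
  have E_sym: "transpose E = E" unfolding E_def transpose_def by (auto simp: vec_eq_iff)
  have "E ** (transpose Q ** A ** Q) ** E = E ** (E' ** E') ** E"
  proof -
    have "E' ** E' = (\<chi> i j. if i = j then d i else 0)"
      unfolding E'_def diagonal_matrix_mult using d by (simp add: vec_eq_iff less_imp_le)
    then show ?thesis by (simp only: diag)
  qed
  also have "\<dots> = (E ** E') ** (E' ** E)" by (simp only: matrix_mul_assoc)
  also have "\<dots> = mat 1" by (simp add: EE)
  finally have EQE: "transpose (Q ** E) ** A ** (Q ** E) = mat 1"
    by (simp add: matrix_transpose_mul E_sym matrix_mul_assoc)
  have inv1: "(Q ** E) ** (E' ** transpose Q) = mat 1"
  proof -
    have "(Q ** E) ** (E' ** transpose Q) = Q ** (E ** E') ** transpose Q"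
      by (simp only: matrix_mul_assoc)
    then show ?thesis by (simp add: EE QQ)
  qed
  have inv2: "(E' ** transpose Q) ** (Q ** E) = mat 1"
  proof -
    have "(E' ** transpose Q) ** (Q ** E) = E' ** (transpose Q ** Q) ** E"
      by (simp only: matrix_mul_assoc)
    then show ?thesis by (simp add: EE QQ)
  qed
  have "(\<integral>\<^sup>+x. f x \<partial>lborel) = ennreal (1 / sqrt (det A)) * (\<integral>\<^sup>+x. f ((Q ** E) *v x) \<partial>lborel)"
    if f[measurable]: "f \<in> borel_measurable borel" for f
  proof -
    have [measurable]: "(\<lambda>x. f (Q *v x)) \<in> borel_measurable borel"
      by (rule measurable_compose[OF _ f])
        (intro borel_measurable_continuous_onI matrix_vector_mult_linear_continuous_on)
    have "(\<integral>\<^sup>+x. f x \<partial>lborel) = (\<integral>\<^sup>+x. f (Q *v x) \<partial>lborel)"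
      using nn_integral_lborel_orthogonal_transformation[OF _ f, of "\<lambda>x. Q *v x"] Q
      by (simp add: orthogonal_transformation_matrix)
    also have "\<dots> = ennreal (\<Prod>i\<in>UNIV. \<bar>1 / sqrt (d i)\<bar>) *
        (\<integral>\<^sup>+x. f (Q *v (\<chi> i. 1 / sqrt (d i) * x $ i)) \<partial>lborel)"
      using d0 by (intro nn_integral_lborel_diagonal) auto
    also have "(\<Prod>i\<in>UNIV. \<bar>1 / sqrt (d i)\<bar>) = 1 / sqrt (det A)"
    proof -
      have "sqrt (\<Prod>i\<in>I. d i) = (\<Prod>i\<in>I. sqrt (d i))" for I
        by (induction I rule: infinite_finite_induct) (simp_all add: real_sqrt_mult)
      then show ?thesis
        unfolding det using less_imp_le[OF d] by (simp add: prod_dividef)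
    qed
    also have "(\<lambda>x. f (Q *v (\<chi> i. 1 / sqrt (d i) * x $ i))) = (\<lambda>x. f ((Q ** E) *v x))"
    proof
      fix x
      have "(\<chi> i. 1 / sqrt (d i) * x $ i) = E *v x"
        unfolding E_def diagonal_matrix_vector_mult ..
      then show "f (Q *v (\<chi> i. 1 / sqrt (d i) * x $ i)) = f ((Q ** E) *v x)"
        by (simp add: matrix_vector_mul_assoc)
    qed
    finally show ?thesis .
  qed
  with inv1 inv2 EQE show "\<exists>R R' :: real^'d^'d. R ** R' = mat 1 \<and> R' ** R = mat 1 \<and> transpose R ** A ** R = mat 1 \<and>
      (\<forall>f\<in>borel_measurable borel.
        (\<integral>\<^sup>+x. f x \<partial>lborel) = ennreal (1 / sqrt (det A)) * (\<integral>\<^sup>+x. f (R *v x) \<partial>lborel))"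
    by blast
qed

text \<open>If \<open>P\<close> whitens \<open>U\<close> and \<open>R\<close> whitens
  \<open>W\<close>, then \<open>T = R ** P'\<close> carries one form to the other through the
  identity, and the two Jacobians divide.\<close>

lemma pos_def_congruence:
  fixes U W :: "real^'d^'d"
  assumes U: "pos_def U" and W: "pos_def W"
  obtains T :: "real^'d^'d"
  where "\<And>x. (T *v x) \<bullet> (W *v (T *v x)) = x \<bullet> (U *v x)"
    and "\<And>f. f \<in> borel_measurable borel \<Longrightarrow>
      (\<integral>\<^sup>+x. f x \<partial>lborel) = ennreal (sqrt (det U / det W)) * (\<integral>\<^sup>+x. f (T *v x) \<partial>lborel)"
proof -
  obtain P P' :: "real^'d^'d" where P: "P ** P' = mat 1" "P' ** P = mat 1" "transpose P ** U ** P = mat 1"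
    and iP: "\<And>f. f \<in> borel_measurable borel \<Longrightarrow>
      (\<integral>\<^sup>+x. f x \<partial>lborel) = ennreal (1 / sqrt (det U)) * (\<integral>\<^sup>+x. f (P *v x) \<partial>lborel)"
    using pos_def_whitening[OF U] by blast
  obtain R R' :: "real^'d^'d" where R: "R ** R' = mat 1" "R' ** R = mat 1" "transpose R ** W ** R = mat 1"
    and iR: "\<And>f. f \<in> borel_measurable borel \<Longrightarrow>
      (\<integral>\<^sup>+x. f x \<partial>lborel) = ennreal (1 / sqrt (det W)) * (\<integral>\<^sup>+x. f (R *v x) \<partial>lborel)"
    using pos_def_whitening[OF W] by blast
  show ?thesis
  proof
    fix x
    have "((R ** P') *v x) \<bullet> (W *v ((R ** P') *v x)) = (P' *v x) \<bullet> (P' *v x)"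
      using quadratic_form_matrix_mult[of R "P' *v x" W] R by (simp add: matrix_vector_mul_assoc)
    also have "\<dots> = (P *v (P' *v x)) \<bullet> (U *v (P *v (P' *v x)))"
      using quadratic_form_matrix_mult[of P "P' *v x" U] P by simp
    also have "\<dots> = x \<bullet> (U *v x)"
      using P by (simp add: matrix_vector_mul_assoc matrix_mul_assoc)
    finally show "((R ** P') *v x) \<bullet> (W *v ((R ** P') *v x)) = x \<bullet> (U *v x)" .
  next
    fix f :: "real^'d \<Rightarrow> ennreal" assume f: "f \<in> borel_measurable borel"
    have "(\<lambda>x. f ((R ** P') *v x)) \<in> borel_measurable borel"
      by (rule measurable_compose[OF _ f])
        (intro borel_measurable_continuous_onI matrix_vector_mult_linear_continuous_on)
    from iP[OF this] have *: "(\<integral>\<^sup>+x. f ((R ** P') *v x) \<partial>lborel) =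
        ennreal (1 / sqrt (det U)) * (\<integral>\<^sup>+x. f (R *v x) \<partial>lborel)"
      using P(2) by (simp add: matrix_vector_mul_assoc matrix_mul_assoc[symmetric] del: matrix_mul_assoc)
    have "sqrt (det U / det W) * (1 / sqrt (det U)) = 1 / sqrt (det W)"
      using det_pos_def[OF U] by (simp add: real_sqrt_divide)
    then show "(\<integral>\<^sup>+x. f x \<partial>lborel) = ennreal (sqrt (det U / det W)) * (\<integral>\<^sup>+x. f ((R ** P') *v x) \<partial>lborel)"
      unfolding iR[OF f] * mult.assoc[symmetric]
      using det_pos_def[OF U] det_pos_def[OF W] by (simp add: ennreal_mult[symmetric])
  qed
qed

text \<open>Compare volumes of the ellipsoids \<open>x \<bullet> (A *v x) \<le> 1\<close>: that of
  \<open>W\<close> lies inside that of \<open>U\<close>, while the congruence makes its volume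
  \<open>sqrt (det U / det W)\<close> times as large.\<close>

lemma det_mono_pos_def:
  fixes U W :: "real^'d^'d"
  assumes U: "pos_def U" and W: "pos_def W" and le: "\<And>x. x \<bullet> (U *v x) \<le> x \<bullet> (W *v x)"
  shows "det U \<le> det W"
proof -
  obtain T where T: "\<And>x. (T *v x) \<bullet> (W *v (T *v x)) = x \<bullet> (U *v x)"
    and iT: "\<And>f. f \<in> borel_measurable borel \<Longrightarrow>
      (\<integral>\<^sup>+x. f x \<partial>lborel) = ennreal (sqrt (det U / det W)) * (\<integral>\<^sup>+x. f (T *v x) \<partial>lborel)"
    using pos_def_congruence[OF U W] by blast
  define E where "E A = {x. x \<bullet> (A *v x) \<le> 1}" for A :: "real^'d^'d"
  have meas: "E A \<in> sets borel" for A
  proof -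
    have "closed (E A)" unfolding E_def
      by (intro closed_Collect_le continuous_intros matrix_vector_mult_linear_continuous_on)
    then show ?thesis by (rule borel_closed)
  qed
  have "emeasure lborel (E W) = (\<integral>\<^sup>+x. indicator (E W) x \<partial>lborel)"
    using meas by simp
  also have "\<dots> = ennreal (sqrt (det U / det W)) * (\<integral>\<^sup>+x. indicator (E W) (T *v x) \<partial>lborel)"
    by (rule iT) (use meas in simp)
  also have "(\<lambda>x. indicator (E W) (T *v x) :: ennreal) = indicator (E U)"
    by (auto simp: E_def indicator_def T fun_eq_iff)
  finally have eq: "emeasure lborel (E W) = ennreal (sqrt (det U / det W)) * emeasure lborel (E U)"
    using meas by simp
  have mono: "emeasure lborel (E W) \<le> emeasure lborel (E U)"
    using le meas by (intro emeasure_mono) (auto simp: E_def intro: order_trans)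
  have symU: "transpose U = U"
    using U by (auto simp: pos_def_def)
  have gU: "gamma_min U > 0" using gamma_min_pos[OF U] .
  \<comment> \<open>Boundedness makes the volume of \<open>E U\<close> finite, and a small ball
    inside it makes the volume positive, so it can be cancelled.\<close>
  have "E U \<subseteq> cball 0 (1 / sqrt (gamma_min U))"
  proof
    fix x assume "x \<in> E U"
    then have "gamma_min U * (norm x)\<^sup>2 \<le> 1"
      using gamma_min_quadratic_form[OF symU, of x] unfolding E_def by simp
    then have "(norm x)\<^sup>2 \<le> (1 / sqrt (gamma_min U))\<^sup>2"
      using gU by (simp add: field_simps power_divide)
    then have "norm x \<le> 1 / sqrt (gamma_min U)"
      by (rule power2_le_imp_le) (use gU in simp)
    then show "x \<in> cball 0 (1 / sqrt (gamma_min U))" by simp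
  qed
  then have fin: "emeasure lborel (E U) < \<infinity>"
    using emeasure_mono[of "E U" "cball 0 (1 / sqrt (gamma_min U))" lborel]
      emeasure_lborel_cball_finite[of "0::real^'d"] by (metis borel_closed closed_cball le_less_trans sets_lborel infinity_ennreal_def)
  have "open {x. x \<bullet> (U *v x) < 1}"
    by (intro open_Collect_less continuous_intros matrix_vector_mult_linear_continuous_on)
  then obtain e where e: "e > 0" "ball 0 e \<subseteq> {x. x \<bullet> (U *v x) < 1}"
    by (metis (mono_tags, lifting) inner_zero_left mem_Collect_eq openE zero_less_one)
  have "0 < emeasure lborel (ball (0::real^'d) e)"
    using content_ball_pos[of e "0::real^'d"] e(1) emeasure_lborel_ball_finite[of "0::real^'d" e]
    by (subst emeasure_eq_ennreal_measure) auto
  also have "\<dots> \<le> emeasure lborel (E U)"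
    using e meas by (intro emeasure_mono) (auto simp: E_def)
  finally have "0 < emeasure lborel (E U)" .
  then obtain m where m: "emeasure lborel (E U) = ennreal m" "m > 0"
    using fin by (metis ennreal_cases ennreal_less_zero_iff infinity_ennreal_def less_irrefl)
  have "sqrt (det U / det W) * m \<le> m"
    using mono m det_pos_def[OF U] det_pos_def[OF W] unfolding eq by (simp add: ennreal_mult[symmetric])
  then have "det U / det W \<le> 1" using m by simp
  then show ?thesis using det_pos_def[OF W] by (simp add: field_simps)
qed

section \<open>Lower bounds for truncated Gaussian mixtures\<close>

text \<open>Averaging over \<open>x\<close> and \<open>- x\<close> replaces \<open>exp (l x)\<close>
  by a hyperbolic cosine, which is at least \<open>1\<close>.\<close>

lemma nn_integral_exp_linear_symmetric_ge:
  fixes g :: "'b::euclidean_space \<Rightarrow> ennreal" and l :: "'b \<Rightarrow> real"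
  assumes [measurable]: "g \<in> borel_measurable borel" "l \<in> borel_measurable borel"
    and even: "\<And>x. g (- x) = g x" and odd: "\<And>x. l (- x) = - l x"
  shows "(\<integral>\<^sup>+x. g x \<partial>lborel) \<le> (\<integral>\<^sup>+x. g x * ennreal (exp (l x)) \<partial>lborel)"
proof -
  let ?I = "\<integral>\<^sup>+x. g x * ennreal (exp (l x)) \<partial>lborel"
  have neg: "orthogonal_transformation (\<lambda>x::'b. - x)"
    by (simp add: orthogonal_transformation_neg)
  have "(\<integral>\<^sup>+x. g (- x) * ennreal (exp (l (- x))) \<partial>lborel) = ?I"
    by (rule nn_integral_lborel_orthogonal_transformation[OF neg]) simp
  then have refl: "(\<integral>\<^sup>+x. g x * ennreal (exp (- l x)) \<partial>lborel) = ?I"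
    by (simp add: even odd)
  have two: "2 \<le> exp t + exp (- t)" for t :: real
    using exp_ge_add_one_self[of t] exp_ge_add_one_self[of "- t"] by linarith
  have "2 * (\<integral>\<^sup>+x. g x \<partial>lborel) = (\<integral>\<^sup>+x. g x * 2 \<partial>lborel)"
    by (simp add: nn_integral_multc mult.commute)
  also have "\<dots> \<le> (\<integral>\<^sup>+x. g x * ennreal (exp (l x)) + g x * ennreal (exp (- l x)) \<partial>lborel)"
  proof (rule nn_integral_mono)
    fix x
    have "ennreal 2 \<le> ennreal (exp (l x)) + ennreal (exp (- l x))"
      using two[of "l x"] by (simp add: ennreal_plus[symmetric] del: ennreal_plus)
    then show "g x * 2 \<le> g x * ennreal (exp (l x)) + g x * ennreal (exp (- l x))"
      by (simp add: distrib_left[symmetric] mult_left_mono)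
  qed
  also have "\<dots> = 2 * ?I"
    by (subst nn_integral_add) (simp_all add: refl mult_2)
  finally show ?thesis
    by (simp add: ennreal_mult_le_mult_iff)
qed

text \<open>Prior and compensator are merged in \<open>A\<close>: for \<open>A = V + U\<close> this
  is the mixture of \<open>exp (x \<bullet> s - a / 2 * (x \<bullet> (V *v x)))\<close> over the
  unnormalized Gaussian density of precision \<open>a U\<close> on the ball, and for
  \<open>A = U\<close>, \<open>s = 0\<close> it is the normalizing constant.\<close>

definition truncated_mixture :: "real \<Rightarrow> real \<Rightarrow> real^'d^'d \<Rightarrow> real^'d \<Rightarrow> ennreal" where
  "truncated_mixture a r A s =
    (\<integral>\<^sup>+x. indicator (cball 0 r) x * ennreal (exp (x \<bullet> s - a / 2 * (x \<bullet> (A *v x)))) \<partial>lborel)"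

text \<open>Complete the square around \<open>m\<close>: after \<open>x \<mapsto> T x + m\<close>
  the exponent is \<open>h m\<close>, plus the prior exponent in \<open>U\<close>, plus an odd
  linear term that cannot lower the integral. The norm condition keeps the image of the ball inside
  the ball.\<close>

lemma truncated_mixture_lower_bound:
  fixes U W :: "real^'d^'d" and m s :: "real^'d" and a r :: real
  assumes U: "pos_def U" and W: "pos_def W" and r: "0 \<le> r"
    and m: "norm m + sqrt (gamma_max U / gamma_min W) * r \<le> r"
  shows "ennreal (sqrt (det U / det W) * exp (m \<bullet> s - a / 2 * (m \<bullet> (W *v m))))
      * truncated_mixture a r U 0 \<le> truncated_mixture a r W s"
proof -
  have symU: "transpose U = U" and symW: "transpose W = W"
    using U W by (auto simp: pos_def_def)
  have gW: "gamma_min W > 0" using gamma_min_pos[OF W] .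
  obtain T where T: "\<And>x. (T *v x) \<bullet> (W *v (T *v x)) = x \<bullet> (U *v x)"
    and iT: "\<And>f. f \<in> borel_measurable borel \<Longrightarrow>
      (\<integral>\<^sup>+x. f x \<partial>lborel) = ennreal (sqrt (det U / det W)) * (\<integral>\<^sup>+x. f (T *v x) \<partial>lborel)"
    using pos_def_congruence[OF U W] by blast
  have T_bound: "norm (T *v x) \<le> sqrt (gamma_max U / gamma_min W) * norm x" for x
  proof -
    have "gamma_min W * (norm (T *v x))\<^sup>2 \<le> gamma_max U * (norm x)\<^sup>2"
      using gamma_min_quadratic_form[OF symW, of "T *v x"] gamma_max_quadratic_form[OF symU, of x]
      by (simp add: T)
    then have "(norm (T *v x))\<^sup>2 \<le> gamma_max U / gamma_min W * (norm x)\<^sup>2"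
      using gW by (simp add: field_simps)
    then have "sqrt ((norm (T *v x))\<^sup>2) \<le> sqrt (gamma_max U / gamma_min W * (norm x)\<^sup>2)"
      by (rule real_sqrt_le_mono)
    then show ?thesis unfolding real_sqrt_mult by simp
  qed
  define h where "h x = x \<bullet> s - a / 2 * (x \<bullet> (W *v x))" for x
  define f where "f x = indicator (cball 0 r) x * ennreal (exp (h x))" for x
  define g where "g x = indicator (cball 0 r) x * ennreal (exp (- a / 2 * (x \<bullet> (U *v x))))" for x
  \<comment> \<open>All terms linear in \<open>x\<close>: the pairing with \<open>s\<close> and the
    cross term of the quadratic form of \<open>W\<close>.\<close>
  define l where "l x = (T *v x) \<bullet> (s - a *\<^sub>R (W *v m))" for x
  have mv[measurable]: "(\<lambda>x. A *v x) \<in> borel_measurable borel" for A :: "real^'d^'d"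
    by (intro borel_measurable_continuous_onI matrix_vector_mult_linear_continuous_on)
  have cb[measurable]: "cball (0::real^'d) r \<in> sets borel" by simp
  have [measurable]: "h \<in> borel_measurable borel" unfolding h_def by measurable
  have fm[measurable]: "f \<in> borel_measurable borel" unfolding f_def by measurable
  have [measurable]: "g \<in> borel_measurable borel" unfolding g_def by measurable
  have [measurable]: "l \<in> borel_measurable borel" unfolding l_def by measurable
  have neg: "A *v (- x) = - (A *v x)" for A :: "real^'d^'d" and x
    using matrix_vector_mult_scaleR[of A "- 1" x] by simp
  have "g (- x) = g x" for x
    unfolding g_def by (simp add: neg indicator_def)
  moreover have "l (- x) = - l x" for x
    unfolding l_def by (simp add: neg)
  ultimately have "(\<integral>\<^sup>+x. g x \<partial>lborel) \<le> (\<integral>\<^sup>+x. g x * ennreal (exp (l x)) \<partial>lborel)"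
    by (intro nn_integral_exp_linear_symmetric_ge) auto
  then have "ennreal (exp (h m)) * (\<integral>\<^sup>+x. g x \<partial>lborel) \<le>
      ennreal (exp (h m)) * (\<integral>\<^sup>+x. g x * ennreal (exp (l x)) \<partial>lborel)"
    by (rule mult_left_mono) simp
  also have "\<dots> = (\<integral>\<^sup>+x. ennreal (exp (h m)) * (g x * ennreal (exp (l x))) \<partial>lborel)"
    by (rule nn_integral_cmult[symmetric]) simp
  also have "\<dots> \<le> (\<integral>\<^sup>+x. f (T *v x + m) \<partial>lborel)"
  proof (rule nn_integral_mono)
    fix x
    show "ennreal (exp (h m)) * (g x * ennreal (exp (l x))) \<le> f (T *v x + m)"
    proof (cases "norm x \<le> r")
      case True
      have "norm (T *v x) \<le> sqrt (gamma_max U / gamma_min W) * r"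
      proof -
        \<comment> \<open>\<open>sqrt\<close> is negative at negative arguments, so the sign of the
          ratio must be known before \<open>norm x \<le> r\<close> is multiplied by the operator
          bound.\<close>
        have "0 \<le> gamma_max U * (norm (1 :: real^'d))\<^sup>2"
          using gamma_max_quadratic_form[OF symU, of 1] U unfolding pos_def_def
          by (metis less_imp_le order_trans zero_neq_one)
        then have "0 \<le> gamma_max U" by (simp add: zero_le_mult_iff)
        then show ?thesis
          using T_bound[of x] True gW by (meson mult_left_mono order_trans real_sqrt_ge_zero divide_nonneg_pos)
      qed
      then have "norm (T *v x + m) \<le> r"
        using m norm_triangle_ineq[of "T *v x" m] by simp
      moreover have "h (T *v x + m) = h m + (- a / 2 * (x \<bullet> (U *v x)) + l x)"
        unfolding h_def l_def quadratic_form_add[OF symW] T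
        using inner_matrix_symmetric[OF symW, of "T *v x" m]
        by (simp add: inner_simps algebra_simps inner_commute)
      moreover have "exp (h m) * (exp (- a / 2 * (x \<bullet> (U *v x))) * exp (l x)) =
          exp (h m + (- a / 2 * (x \<bullet> (U *v x)) + l x))"
        by (simp only: exp_add)
      ultimately show ?thesis
        using True unfolding f_def g_def by (simp add: ennreal_mult[symmetric])
    qed (simp add: g_def)
  qed
  finally have "ennreal (sqrt (det U / det W)) * (ennreal (exp (h m)) * (\<integral>\<^sup>+x. g x \<partial>lborel)) \<le>
      ennreal (sqrt (det U / det W)) * (\<integral>\<^sup>+x. f (T *v x + m) \<partial>lborel)"
    by (rule mult_left_mono) simp
  also have "\<dots> = (\<integral>\<^sup>+x. f (x + m) \<partial>lborel)"
    by (rule iT[symmetric]) simp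
  also have "\<dots> = (\<integral>\<^sup>+x. f x \<partial>lborel)"
    by (rule nn_integral_lborel_translation) simp
  finally show ?thesis
    using det_pos_def[OF U] det_pos_def[OF W]
    unfolding truncated_mixture_def f_def g_def h_def by (simp add: ennreal_mult mult.assoc)
qed

text \<open>On the ball the exponential lies between a positive constant and \<open>1\<close>, and
  the ball has finite positive volume. This allows the normalizing constant to be cancelled in the
  maximal inequality.\<close>

lemma truncated_mixture_0_bounds:
  fixes U :: "real^'d^'d"
  assumes U: "pos_def U" and a: "0 \<le> a" and r: "0 < r"
  shows "0 < truncated_mixture a r U 0" "truncated_mixture a r U 0 < \<infinity>"
proof -
  let ?B = "cball (0::real^'d) r"
  have symU: "transpose U = U" using U by (simp add: pos_def_def)
  have Bpos: "0 < emeasure lborel ?B"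
    using content_cball_pos[OF r, of "0::real^'d"] emeasure_lborel_cball_finite[of "0::real^'d" r]
    by (subst emeasure_eq_ennreal_measure) auto
  define e where "e = exp (- a / 2 * (\<bar>gamma_max U\<bar> * r\<^sup>2))"
  have "0 < ennreal e * emeasure lborel ?B"
    using Bpos unfolding e_def by (simp add: ennreal_zero_less_mult_iff)
  also have "\<dots> = (\<integral>\<^sup>+x. ennreal e * indicator ?B x \<partial>lborel)"
    by (simp add: nn_integral_cmult_indicator)
  also have "\<dots> \<le> truncated_mixture a r U 0"
    unfolding truncated_mixture_def
  proof (rule nn_integral_mono)
    fix x
    have "a / 2 * (x \<bullet> (U *v x)) \<le> a / 2 * (\<bar>gamma_max U\<bar> * r\<^sup>2)" if "norm x \<le> r"
    proof -
      have "gamma_max U * (norm x)\<^sup>2 \<le> \<bar>gamma_max U\<bar> * r\<^sup>2"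
        using that by (intro mult_mono power_mono) auto
      then show ?thesis
        using gamma_max_quadratic_form[OF symU, of x] a by (intro mult_left_mono) auto
    qed
    then show "ennreal e * indicator ?B x \<le>
        indicator ?B x * ennreal (exp (x \<bullet> 0 - a / 2 * (x \<bullet> (U *v x))))"
      unfolding e_def by (auto simp: indicator_def intro!: ennreal_leI)
  qed
  finally show "0 < truncated_mixture a r U 0" .
  have nn: "0 \<le> x \<bullet> (U *v x)" for x
    using U unfolding pos_def_def by (cases "x = 0") (auto simp: less_imp_le)
  have "truncated_mixture a r U 0 \<le> (\<integral>\<^sup>+x. indicator ?B x \<partial>lborel)"
    unfolding truncated_mixture_def
    using nn a by (intro nn_integral_mono) (auto simp: indicator_def)
  also have "\<dots> < \<infinity>"
    using emeasure_lborel_cball_finite[of "0::real^'d" r] by simp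
  finally show "truncated_mixture a r U 0 < \<infinity>" .
qed

section \<open>Time-uniform bounds for mixtures\<close>

context filtered_prob_space
begin

lemma sets_F_M: "A \<in> sets (F k) \<Longrightarrow> A \<in> sets M"
  using subalgebra_F[of k] by (auto simp: subalgebra_def)

lemma supermartingale_step:
  assumes L: "supermartingale M F L" and A: "A \<in> sets (F k)"
  shows "(\<integral>\<omega>\<in>A. L (Suc k) \<omega> \<partial>M) \<le> (\<integral>\<omega>\<in>A. L k \<omega> \<partial>M)"
proof -
  interpret S: sigma_finite_subalgebra M "F k"
    by (rule finite_measure_subalgebra_is_sigma_finite)
      (unfold_locales, rule subalgebra_F)
  have int: "integrable M (L j)" for j using L by (simp add: supermartingale_def)
  have AM: "A \<in> sets M" using A by (rule sets_F_M)
  have "(\<integral>\<omega>\<in>A. L (Suc k) \<omega> \<partial>M) = (\<integral>\<omega>\<in>A. real_cond_exp M (F k) (L (Suc k)) \<omega> \<partial>M)"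
    by (rule S.real_cond_exp_intA[OF int A])
  also have "\<dots> \<le> (\<integral>\<omega>\<in>A. L k \<omega> \<partial>M)"
    unfolding set_lebesgue_integral_def
  proof (rule integral_mono_AE)
    show "integrable M (\<lambda>\<omega>. indicat_real A \<omega> *\<^sub>R real_cond_exp M (F k) (L (Suc k)) \<omega>)"
      using S.real_cond_exp_int(1)[OF int] AM by (intro integrable_mult_indicator)
    show "integrable M (\<lambda>\<omega>. indicat_real A \<omega> *\<^sub>R L k \<omega>)"
      using int AM by (intro integrable_mult_indicator)
    have "AE \<omega> in M. real_cond_exp M (F k) (L (Suc k)) \<omega> \<le> L k \<omega>"
      using L unfolding supermartingale_def by (meson lessI less_imp_le)
    then show "AE \<omega> in M. indicat_real A \<omega> *\<^sub>R real_cond_exp M (F k) (L (Suc k)) \<omega> \<le> indicat_real A \<omega> *\<^sub>R L k \<omega>"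
      by eventually_elim (simp add: mult_left_mono)
  qed
  finally show ?thesis .
qed

text \<open>Optional stopping at the time that equals \<open>k\<close> on \<open>A k\<close>.\<close>

lemma supermartingale_sum_disjoint_le:
  assumes L: "supermartingale M F L" and nonneg: "\<And>t. AE \<omega> in M. 0 \<le> L t \<omega>"
    and L0: "AE \<omega> in M. L 0 \<omega> \<le> 1"
    and A: "\<And>k. A k \<in> sets (F k)" and disj: "disjoint_family A"
  shows "(\<Sum>k\<le>n. \<integral>\<omega>\<in>A k. L k \<omega> \<partial>M) \<le> 1"
proof -
  \<comment> \<open>\<open>B n\<close> is the event that no \<open>A k\<close> with
    \<open>k \<le> n\<close> has occurred.\<close>
  define B where "B n = space M - (\<Union>k\<le>n. A k)" for n
  have int: "integrable M (L j)" for j using L by (simp add: supermartingale_def)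
  have AF: "A k \<in> sets (F n)" if "k \<le> n" for k n
    using A sets_F_mono[OF that] by blast
  have BF: "B n \<in> sets (F n)" for n
    unfolding B_def space_F[of n, symmetric] using AF by (intro sets.Diff sets.top sets.finite_UN) auto
  have AB: "A (Suc n) \<inter> B (Suc n) = {}" "A (Suc n) \<union> B (Suc n) = B n" for n
  proof -
    show "A (Suc n) \<inter> B (Suc n) = {}" unfolding B_def by auto
    have "A (Suc n) \<inter> A k = {}" if "k \<le> n" for k
      using disj that by (auto simp: disjoint_family_on_def)
    moreover have "A (Suc n) \<subseteq> space M"
      using sets.sets_into_space[OF sets_F_M[OF A]] .
    ultimately show "A (Suc n) \<union> B (Suc n) = B n" unfolding B_def by (auto simp: le_Suc_eq)
  qed
  have split: "(\<integral>\<omega>\<in>X \<union> Y. L k \<omega> \<partial>M) = (\<integral>\<omega>\<in>X. L k \<omega> \<partial>M) + (\<integral>\<omega>\<in>Y. L k \<omega> \<partial>M)"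
    if "X \<inter> Y = {}" "X \<in> sets M" "Y \<in> sets M" for X Y k
    using that int unfolding set_integrable_def
    by (intro set_integral_Un) (auto simp: set_integrable_def intro!: integrable_mult_indicator[of _ M "L k", simplified])
  \<comment> \<open>The induction also carries the mass not yet stopped: the left side is the
    expectation of \<open>L\<close> at the stopping time capped at \<open>n\<close>.\<close>
  have "(\<Sum>k\<le>n. \<integral>\<omega>\<in>A k. L k \<omega> \<partial>M) + (\<integral>\<omega>\<in>B n. L n \<omega> \<partial>M) \<le> (\<integral>\<omega>. L 0 \<omega> \<partial>M)"
  proof (induction n)
    case 0
    have "(\<integral>\<omega>\<in>A 0. L 0 \<omega> \<partial>M) + (\<integral>\<omega>\<in>B 0. L 0 \<omega> \<partial>M) = (\<integral>\<omega>\<in>A 0 \<union> B 0. L 0 \<omega> \<partial>M)"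
      by (rule split[symmetric]) (auto simp: B_def intro: sets_F_M A BF)
    also have "A 0 \<union> B 0 = space M"
      using sets.sets_into_space[OF sets_F_M[OF A[of 0]]] by (auto simp: B_def)
    finally show ?case by (simp add: set_integral_space int)
  next
    case (Suc n)
    have "(\<integral>\<omega>\<in>A (Suc n). L (Suc n) \<omega> \<partial>M) + (\<integral>\<omega>\<in>B (Suc n). L (Suc n) \<omega> \<partial>M)
        = (\<integral>\<omega>\<in>B n. L (Suc n) \<omega> \<partial>M)"
      using split[OF AB(1)[of n] sets_F_M[OF A] sets_F_M[OF BF], of "Suc n"] AB(2)[of n] by simp
    also have "\<dots> \<le> (\<integral>\<omega>\<in>B n. L n \<omega> \<partial>M)"
      by (rule supermartingale_step[OF L BF])
    finally show ?case using Suc by simp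
  qed
  moreover have "0 \<le> (\<integral>\<omega>\<in>B n. L n \<omega> \<partial>M)"
    unfolding set_lebesgue_integral_def
    by (rule integral_nonneg_AE) (use nonneg[of n] in \<open>eventually_elim, simp\<close>)
  moreover have "(\<integral>\<omega>. L 0 \<omega> \<partial>M) \<le> (\<integral>\<omega>. 1 \<partial>M)"
    by (rule integral_mono_AE) (auto simp: int L0)
  ultimately show ?thesis by (simp add: prob_space)
qed

text \<open>The dominating \<open>L\<close> is chosen separately for each direction and each
  \<lambda>, with no joint measurability, so it cannot be integrated over a mixing measure. Passing
  to \<open>X\<close> leaves an inequality free of \<open>L\<close>, which can be mixed.\<close>

lemma dominated_sum_disjoint_le:
  assumes L: "supermartingale M F L" and nonneg: "\<And>t. AE \<omega> in M. 0 \<le> L t \<omega>"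
    and L0: "AE \<omega> in M. L 0 \<omega> \<le> 1"
    and X: "\<And>t. AE \<omega> in M. X t \<omega> \<le> L t \<omega>"
    and A: "\<And>k. A k \<in> sets (F k)" and disj: "disjoint_family A"
  shows "(\<Sum>k\<le>n. \<integral>\<^sup>+\<omega>. ennreal (X k \<omega>) * indicator (A k) \<omega> \<partial>M) \<le> 1"
proof -
  have int: "integrable M (L j)" for j using L by (simp add: supermartingale_def)
  have intA: "integrable M (\<lambda>\<omega>. indicat_real (A k) \<omega> *\<^sub>R L k \<omega>)" for k
    using int sets_F_M[OF A] by (intro integrable_mult_indicator)
  have nnA: "AE \<omega> in M. 0 \<le> indicat_real (A k) \<omega> *\<^sub>R L k \<omega>" for k
    using nonneg[of k] by eventually_elim simp
  have "(\<integral>\<^sup>+\<omega>. ennreal (X k \<omega>) * indicator (A k) \<omega> \<partial>M) \<le> ennreal (\<integral>\<omega>\<in>A k. L k \<omega> \<partial>M)" for k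
  proof -
    have "(\<integral>\<^sup>+\<omega>. ennreal (X k \<omega>) * indicator (A k) \<omega> \<partial>M)
        \<le> (\<integral>\<^sup>+\<omega>. ennreal (indicat_real (A k) \<omega> *\<^sub>R L k \<omega>) \<partial>M)"
      by (rule nn_integral_mono_AE)
        (use X[of k] in \<open>eventually_elim, auto simp: indicator_def ennreal_leI\<close>)
    also have "\<dots> = ennreal (\<integral>\<omega>\<in>A k. L k \<omega> \<partial>M)"
      unfolding set_lebesgue_integral_def by (rule nn_integral_eq_integral[OF intA nnA])
    finally show ?thesis .
  qed
  then have "(\<Sum>k\<le>n. \<integral>\<^sup>+\<omega>. ennreal (X k \<omega>) * indicator (A k) \<omega> \<partial>M)
      \<le> (\<Sum>k\<le>n. ennreal (\<integral>\<omega>\<in>A k. L k \<omega> \<partial>M))"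
    by (rule sum_mono)
  also have "\<dots> = ennreal (\<Sum>k\<le>n. \<integral>\<omega>\<in>A k. L k \<omega> \<partial>M)"
    unfolding set_lebesgue_integral_def
    by (rule sum_ennreal) (rule integral_nonneg_AE[OF nnA])
  also have "\<dots> \<le> 1"
    using supermartingale_sum_disjoint_le[OF L nonneg L0 A disj, of n] by simp
  finally show ?thesis .
qed

text \<open>Let \<open>A k\<close> be the event that the mixture first reaches \<open>y\<close> at
  time \<open>k\<close>. On it \<open>y\<close> is at most the mixed value; Tonelli moves the
  expectation inside the mixing integral, where the hypothesis bounds the stopped sum for each
  \<open>x\<close> separately.\<close>

lemma ville_mixture:
  fixes X :: "nat \<Rightarrow> 'a \<Rightarrow> 'b \<Rightarrow> ennreal" and y :: ennreal
  assumes N: "sigma_finite_measure N"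
    and meas: "\<And>k. (\<lambda>(\<omega>, x). X k \<omega> x) \<in> borel_measurable (F k \<Otimes>\<^sub>M N)"
    and g: "g \<in> borel_measurable N"
    and le: "\<And>x A n. x \<in> space N \<Longrightarrow> (\<And>k. A k \<in> sets (F k)) \<Longrightarrow> disjoint_family A \<Longrightarrow>
      (\<Sum>k\<le>n. \<integral>\<^sup>+\<omega>. X k \<omega> x * indicator (A k) \<omega> \<partial>M) \<le> g x"
  shows "{\<omega>\<in>space M. \<exists>k. y \<le> (\<integral>\<^sup>+x. X k \<omega> x \<partial>N)} \<in> sets M"
    and "y * emeasure M {\<omega>\<in>space M. \<exists>k. y \<le> (\<integral>\<^sup>+x. X k \<omega> x \<partial>N)} \<le> (\<integral>\<^sup>+x. g x \<partial>N)"
proof -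
  interpret N: sigma_finite_measure N by fact
  interpret P: pair_sigma_finite M N ..
  define Y where "Y k \<omega> = (\<integral>\<^sup>+x. X k \<omega> x \<partial>N)" for k \<omega>
  define E where "E k = {\<omega>\<in>space M. y \<le> Y k \<omega>}" for k
  define A where "A = disjointed E"
  have "Y k \<in> borel_measurable (F k)" for k
    unfolding Y_def by (rule N.borel_measurable_nn_integral) (rule meas)
  then have EF: "E k \<in> sets (F k)" for k
    unfolding E_def space_F[of k, symmetric] by measurable
  have AF: "A k \<in> sets (F k)" for k
    unfolding A_def disjointed_def using EF sets_F_mono by (intro sets.Diff sets.finite_UN) (auto, metis less_imp_le subsetD)
  have AM: "A k \<in> sets M" for k using AF by (rule sets_F_M)
  have disj: "disjoint_family A" unfolding A_def by (rule disjoint_family_disjointed)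
  have eq: "{\<omega>\<in>space M. \<exists>k. y \<le> (\<integral>\<^sup>+x. X k \<omega> x \<partial>N)} = (\<Union>k. A k)"
    unfolding A_def UN_disjointed_eq E_def Y_def by auto
  show "{\<omega>\<in>space M. \<exists>k. y \<le> (\<integral>\<^sup>+x. X k \<omega> x \<partial>N)} \<in> sets M"
    unfolding eq using AM by auto
  \<comment> \<open>Tonelli is applied over \<open>M\<close>, so joint measurability is lifted from
    the sub-algebra \<open>F k\<close>.\<close>
  have XM[measurable]: "(\<lambda>(\<omega>, x). X k \<omega> x) \<in> borel_measurable (M \<Otimes>\<^sub>M N)" for k
  proof -
    have "(\<lambda>p. (fst p, snd p)) \<in> M \<Otimes>\<^sub>M N \<rightarrow>\<^sub>M F k \<Otimes>\<^sub>M N"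
      by (intro measurable_Pair measurable_snd
          measurable_compose[OF measurable_fst measurable_from_subalg[OF subalgebra_F[of k] measurable_ident_sets[OF HOL.refl]]])
    then show ?thesis using measurable_compose[OF _ meas[of k]] by auto
  qed
  have A_ind[measurable]: "A k \<in> sets M" for k by (rule AM)
  have "y * (\<Sum>k<n. emeasure M (A k)) \<le> (\<integral>\<^sup>+x. g x \<partial>N)" for n
  proof -
    have "y * (\<Sum>k<n. emeasure M (A k)) = (\<Sum>k<n. \<integral>\<^sup>+\<omega>. y * indicator (A k) \<omega> \<partial>M)"
      by (simp add: sum_distrib_left nn_integral_cmult_indicator)
    also have "\<dots> \<le> (\<Sum>k<n. \<integral>\<^sup>+\<omega>. Y k \<omega> * indicator (A k) \<omega> \<partial>M)"
    proof (intro sum_mono nn_integral_mono)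
      fix k \<omega>
      show "y * indicator (A k) \<omega> \<le> Y k \<omega> * indicator (A k) \<omega>"
        using disjointed_subset[of E k] unfolding A_def E_def by (auto simp: indicator_def)
    qed
    also have "\<dots> = (\<Sum>k<n. \<integral>\<^sup>+x. (\<integral>\<^sup>+\<omega>. X k \<omega> x * indicator (A k) \<omega> \<partial>M) \<partial>N)"
    proof (rule sum.cong[OF HOL.refl])
      fix k
      have "(\<integral>\<^sup>+\<omega>. Y k \<omega> * indicator (A k) \<omega> \<partial>M) = (\<integral>\<^sup>+\<omega>. (\<integral>\<^sup>+x. X k \<omega> x * indicator (A k) \<omega> \<partial>N) \<partial>M)"
        unfolding Y_def by (intro nn_integral_cong nn_integral_multc[symmetric])
           (use XM[of k] in measurable)
      also have "\<dots> = (\<integral>\<^sup>+x. (\<integral>\<^sup>+\<omega>. X k \<omega> x * indicator (A k) \<omega> \<partial>M) \<partial>N)"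
        by (rule P.Fubini'[symmetric]) measurable
      finally show "(\<integral>\<^sup>+\<omega>. Y k \<omega> * indicator (A k) \<omega> \<partial>M) =
        (\<integral>\<^sup>+x. (\<integral>\<^sup>+\<omega>. X k \<omega> x * indicator (A k) \<omega> \<partial>M) \<partial>N)" .
    qed
    also have "\<dots> = (\<integral>\<^sup>+x. (\<Sum>k<n. \<integral>\<^sup>+\<omega>. X k \<omega> x * indicator (A k) \<omega> \<partial>M) \<partial>N)"
      by (rule nn_integral_sum[symmetric]) measurable
    also have "\<dots> \<le> (\<integral>\<^sup>+x. g x \<partial>N)"
    proof (rule nn_integral_mono)
      fix x assume x: "x \<in> space N"
      have "(\<Sum>k<n. \<integral>\<^sup>+\<omega>. X k \<omega> x * indicator (A k) \<omega> \<partial>M)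
          \<le> (\<Sum>k\<le>n. \<integral>\<^sup>+\<omega>. X k \<omega> x * indicator (A k) \<omega> \<partial>M)"
        by (rule sum_mono2) auto
      also have "\<dots> \<le> g x" using le[OF x AF disj] .
      finally show "(\<Sum>k<n. \<integral>\<^sup>+\<omega>. X k \<omega> x * indicator (A k) \<omega> \<partial>M) \<le> g x" .
    qed
    finally show ?thesis .
  qed
  \<comment> \<open>Letting \<open>n\<close> grow turns the finite sums into the probability that
    the level is ever reached.\<close>
  then have "(SUP n. y * (\<Sum>k<n. emeasure M (A k))) \<le> (\<integral>\<^sup>+x. g x \<partial>N)"
    by (rule SUP_least)
  moreover have "(SUP n. y * (\<Sum>k<n. emeasure M (A k))) = y * emeasure M (\<Union>k. A k)"
  proof -
    have "range A \<subseteq> sets M" using AM by auto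
    from suminf_emeasure[OF this disj] show ?thesis
      by (simp add: SUP_mult_left_ennreal[symmetric] suminf_eq_SUP)
  qed
  ultimately show "y * emeasure M {\<omega>\<in>space M. \<exists>k. y \<le> (\<integral>\<^sup>+x. X k \<omega> x \<partial>N)} \<le> (\<integral>\<^sup>+x. g x \<partial>N)"
    unfolding eq by simp
qed

end

section \<open>Scalar inequalities\<close>

lemma xi_pos: "0 < c \<Longrightarrow> 0 \<le> x \<Longrightarrow> 0 < xi c x"
  unfolding xi_def by (intro divide_pos_pos add_pos_nonneg) auto

text \<open>The radius \<open>\<xi> (1 / D)\<close> is where \<open>\<lambda> \<mapsto> \<psi>\<^sub>G \<lambda> / \<lambda> + D / \<lambda>\<close> balances its two terms.\<close>

lemma
  fixes c D :: real
  assumes c: "0 < c" and D: "0 < D"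
  defines "r \<equiv> xi c (1 / D)"
  shows xi_balance: "r\<^sup>2 = 2 * D * (1 - c * r)"
    and xi_less: "c * r < 1"
    and inverse_xi_le: "1 / r \<le> c + 1 / sqrt (2 * D)"
proof -
  define q where "q = sqrt (c\<^sup>2 + 2 / D)"
  have r: "r = 2 / (c + q)" unfolding r_def xi_def q_def by simp
  have q2: "q\<^sup>2 = c\<^sup>2 + 2 / D" unfolding q_def using D by simp
  have "sqrt (c\<^sup>2) < q" unfolding q_def using D by (intro real_sqrt_less_mono) simp
  then have qc: "c < q" using c by simp
  have e: "1 - c * r = (q - c) / (c + q)"
    unfolding r using c qc by (simp add: field_simps)
  show "c * r < 1" using e c qc by (smt (verit) divide_pos_pos)
  have "q\<^sup>2 - c\<^sup>2 = (q - c) * (c + q)" by (simp add: algebra_simps power2_eq_square)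
  \<comment> \<open>Both sides of the balance identity equal \<open>4 / (c + q)\<^sup>2\<close>,
    because \<open>q\<^sup>2 - c\<^sup>2 = 2 / D\<close>.\<close>
  then have "2 * D * (1 - c * r) = 2 * D * (q\<^sup>2 - c\<^sup>2) / (c + q)\<^sup>2"
    unfolding e using c qc by (simp add: power2_eq_square)
  also have "\<dots> = r\<^sup>2" unfolding q2 r using D by (simp add: power_divide)
  finally show "r\<^sup>2 = 2 * D * (1 - c * r)" ..
  have "q \<le> sqrt (c\<^sup>2) + sqrt (2 / D)"
    unfolding q_def using D by (intro sqrt_add_le_add_sqrt) auto
  moreover have "sqrt (2 / D) = 2 / sqrt (2 * D)"
  proof -
    have "sqrt (2 / D) = sqrt (4 / (2 * D))" by simp
    then show ?thesis by (simp only: real_sqrt_divide real_sqrt_four)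
  qed
  ultimately show "1 / r \<le> c + 1 / sqrt (2 * D)" unfolding r using c by simp
qed

text \<open>When positive, \<open>H\<close> has the form \<open>a - \<rho> * b\<close> with
  \<open>a \<le> b\<close> and \<open>a \<le> 1 / 2\<close>, so it is at most
  \<open>a * (1 - \<rho>)\<close>; its positivity then forces \<open>\<rho> < 1\<close>.\<close>

lemma H_term_le:
  fixes U V :: "real^'d^'d"
  assumes c: "0 < c" and q: "0 \<le> gamma_max U / gamma_min (V + U)" and H: "H_term c U V \<noteq> 0"
  defines "\<rho> \<equiv> sqrt (gamma_max U / gamma_min (V + U))"
  shows "0 < H_term c U V" "\<rho> < 1" "H_term c U V \<le> (1 - \<rho>) / 2"
proof -
  define a where "a = sqrt ((sqrt (c\<^sup>2 + 2 * c) - c) / (3 + c))"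
  define b where "b = sqrt (xi c c)"
  have rho: "0 \<le> \<rho>" unfolding \<rho>_def using q by simp
  have Hab: "H_term c U V = max 0 (a - \<rho> * b)"
    unfolding H_term_def a_def b_def \<rho>_def by (simp add: real_sqrt_mult[symmetric])
  with H show H0: "0 < H_term c U V" by (simp add: max_def split: if_splits)
  with Hab have Hab: "H_term c U V = a - \<rho> * b" by (simp add: max_def split: if_splits)
  have gt: "c < sqrt (c\<^sup>2 + 2 * c)" using c by (intro real_less_rsqrt) simp
  \<comment> \<open>Rationalizing \<open>xi c c\<close> shows that \<open>a\<close> is
    \<open>b\<close> times \<open>sqrt (c / (3 + c))\<close>.\<close>
  have xi: "c * xi c c = sqrt (c\<^sup>2 + 2 * c) - c"
  proof -
    have "(sqrt (c\<^sup>2 + 2 * c) - c) * (c + sqrt (c\<^sup>2 + 2 * c)) = 2 * c"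
      using c by (simp add: algebra_simps power2_eq_square[symmetric])
    then show ?thesis unfolding xi_def using gt c by (simp add: field_simps)
  qed
  have "a \<le> b"
    unfolding a_def b_def xi[symmetric] using c xi_pos[of c c]
    by (intro real_sqrt_le_mono) (simp add: field_simps)
  \<comment> \<open>This is \<open>a \<le> 1 / 2\<close> solved for the root. Squaring leaves
    \<open>9 * c\<^sup>2 - 2 * c + 9\<close>, which is the sum of squares below.\<close>
  have "sqrt (c\<^sup>2 + 2 * c) \<le> (5 * c + 3) / 4"
  proof (rule real_le_lsqrt)
    have "0 \<le> (c - 1)\<^sup>2 + 8 * c\<^sup>2 + 8" by simp
    then show "c\<^sup>2 + 2 * c \<le> ((5 * c + 3) / 4)\<^sup>2"
      by (simp add: power2_eq_square field_simps)
  qed (use c in auto)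
  then have "(sqrt (c\<^sup>2 + 2 * c) - c) / (3 + c) \<le> (1 / 2)\<^sup>2"
    using c by (simp add: field_simps power2_eq_square)
  then have "a \<le> sqrt ((1 / 2)\<^sup>2)" unfolding a_def by (rule real_sqrt_le_mono)
  then have a2: "a \<le> 1 / 2" by simp
  have a0: "0 < a" unfolding a_def using gt c by simp
  have le: "H_term c U V \<le> a * (1 - \<rho>)"
    unfolding Hab using mult_left_mono[OF \<open>a \<le> b\<close> rho] by (simp add: algebra_simps)
  with H0 have "0 < a * (1 - \<rho>)" by linarith
  with a0 show "\<rho> < 1" by (simp add: zero_less_mult_iff)
  then have "a * (1 - \<rho>) \<le> 1 / 2 * (1 - \<rho>)"
    using a2 by (intro mult_right_mono) auto
  with le show "H_term c U V \<le> (1 - \<rho>) / 2" by simp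
qed

text \<open>The choice of \<open>r\<close> balances the quadratic term with \<open>D'\<close>, so
  the hypothesis becomes \<open>((1 - \<rho>) * r) * n \<le> 2 * D\<close>. It remains to bound
  \<open>1 / r\<close> and to use \<open>2 / (1 - \<rho>) \<le> 1 / H\<close>.\<close>

lemma optimized_radius_bound:
  fixes c D D' \<rho> H n v :: real
  assumes c: "0 < c" and D: "0 < D'" "D' \<le> D" "D \<le> 2 * D'" and rho: "0 \<le> \<rho>" "\<rho> < 1"
    and H: "0 < H" "H \<le> (1 - \<rho>) / 2"
  defines "r \<equiv> xi c (1 / D')"
  assumes n: "((1 - \<rho>) * r) * n \<le> 1 / (1 - c * r) / 2 * ((1 - \<rho>) * r)\<^sup>2 + D"
  shows "n \<le> (c * D + 1.51 * sqrt D + xi c c * max v (sqrt (D / 2))) / H"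
proof -
  have r: "0 < r" unfolding r_def using c D by (intro xi_pos) auto
  have cr: "c * r < 1" and r2: "r\<^sup>2 = 2 * D' * (1 - c * r)" and r_inv: "1 / r \<le> c + 1 / sqrt (2 * D')"
    unfolding r_def using xi_less[OF c D(1)] xi_balance[OF c D(1)] inverse_xi_le[OF c D(1)] by auto
  have "1 / (1 - c * r) / 2 * ((1 - \<rho>) * r)\<^sup>2 = (1 - \<rho>)\<^sup>2 * D'"
    unfolding power_mult_distrib r2 using cr by (simp add: field_simps)
  also have "\<dots> \<le> 1 * D"
    using rho D by (intro mult_mono) (auto simp: power_le_one)
  finally have "((1 - \<rho>) * r) * n \<le> 2 * D" using n by simp
  then have "n \<le> 2 * D * (1 / r) / (1 - \<rho>)"
    using r rho by (simp add: field_simps)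
  also have "\<dots> \<le> 2 * D * (c + 1 / sqrt D) / (1 - \<rho>)"
  proof -
    \<comment> \<open>The factor \<open>2\<close> under the root pays for the grid value:
      \<open>D \<le> 2 * D'\<close>.\<close>
    have "1 / sqrt (2 * D') \<le> 1 / sqrt D"
      using D by (intro divide_left_mono) auto
    then have "1 / r \<le> c + 1 / sqrt D" using r_inv by linarith
    then show ?thesis using D rho by (intro divide_right_mono mult_left_mono) auto
  qed
  also have "2 * D * (c + 1 / sqrt D) = 2 * (c * D + sqrt D)"
    using real_div_sqrt[of D] D by (simp add: distrib_left mult.assoc)
  also have "2 * (c * D + sqrt D) / (1 - \<rho>) \<le> (c * D + sqrt D) / H"
  proof -
    have "(c * D + sqrt D) * (2 * H) \<le> (c * D + sqrt D) * (1 - \<rho>)"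
      using H D c by (intro mult_left_mono) auto
    then show ?thesis using H rho by (simp add: field_simps)
  qed
  also have "\<dots> \<le> (c * D + 1.51 * sqrt D + xi c c * max v (sqrt (D / 2))) / H"
  proof (rule divide_right_mono)
    have "0 \<le> xi c c * max v (sqrt (D / 2))"
      using xi_pos[of c c] c D by (intro mult_nonneg_nonneg) (auto simp: le_max_iff_disj)
    moreover have "sqrt D \<le> 1.51 * sqrt D" using D by simp
    ultimately show "c * D + sqrt D \<le> c * D + 1.51 * sqrt D + xi c c * max v (sqrt (D / 2))"
      by linarith
  qed (use H in simp)
  finally show ?thesis .
qed

text \<open>The value of \<^const>\<open>D_term\<close> for \<open>det (V + U) = 2 ^ j\<close>, up to truncation at \<open>0\<close>.\<close>

definition grid_D :: "real \<Rightarrow> real \<Rightarrow> nat \<Rightarrow> real" where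
  "grid_D \<delta> u j = max 0 (1/2 * ln (2 ^ j / u)) + 1.5 + 2 * ln (real j + 1) + ln (1 / \<delta>)"

lemma ln_inverse_delta_ge_1:
  assumes "0 < \<delta>" "\<delta> \<le> 1 / exp 1"
  shows "1 \<le> ln (1 / \<delta> :: real)"
proof -
  have "exp 1 \<le> 1 / \<delta>" using assms by (simp add: field_simps)
  then have "ln (exp 1) \<le> ln (1 / \<delta>)" using assms by (subst ln_le_cancel_iff) auto
  then show ?thesis by simp
qed

lemma grid_D_pos:
  assumes "0 < \<delta>" "\<delta> \<le> 1 / exp 1"
  shows "2.5 \<le> grid_D \<delta> u j"
proof -
  have "0 \<le> 2 * ln (real j + 1)" by simp
  then show ?thesis unfolding grid_D_def using ln_inverse_delta_ge_1[OF assms] by linarith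
qed

lemma floor_log2_bounds:
  assumes w: "1 \<le> w"
  defines "j \<equiv> nat \<lfloor>log 2 w\<rfloor>"
  shows "real j \<le> log 2 w" "log 2 w < real j + 1" "2 ^ j \<le> w" "w < 2 * 2 ^ j"
proof -
  have l: "0 \<le> log 2 w" using w by simp
  \<comment> \<open>The logarithm is nonnegative, so \<open>nat\<close> does not truncate.\<close>
  have "real j = of_int \<lfloor>log 2 w\<rfloor>" unfolding j_def using l by simp
  then show j: "real j \<le> log 2 w" "log 2 w < real j + 1"
    using of_int_floor_le[of "log 2 w"] floor_correct[of "log 2 w"] by linarith+
  have "2 powr real j \<le> w" using j(1) w by (subst (asm) le_log_iff) auto
  then show "2 ^ j \<le> w" by (simp add: powr_realpow)
  have "w < 2 powr (real j + 1)" using j(2) w by (subst (asm) log_less_iff) auto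
  then show "w < 2 * 2 ^ j" by (simp add: powr_add powr_realpow)
qed

text \<open>Rounding \<open>det (V + U)\<close> down to \<open>2 ^ j\<close> can only lower the
  terms, and by a bounded amount. The third bound keeps the true determinant, which the mixture
  bound produces, and rounds only the term that pays for the weight \<open>(j + 1)\<^sup>2\<close>
  in the union bound.\<close>

lemma grid_D_bounds:
  fixes U V :: "real^'d^'d"
  assumes \<delta>: "0 < \<delta>" "\<delta> \<le> 1 / exp 1" and u: "0 < det U" "det U \<le> det (V + U)" and w: "1 \<le> det (V + U)"
  defines "j \<equiv> nat \<lfloor>log 2 (det (V + U))\<rfloor>"
  shows "grid_D \<delta> (det U) j \<le> D_term \<delta> U V" "D_term \<delta> U V \<le> 2 * grid_D \<delta> (det U) j"
    "1/2 * ln (det (V + U) / det U) + 1.5 + 2 * ln (real j + 1) + ln (1 / \<delta>) \<le> D_term \<delta> U V"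
proof -
  define u where "u = det U"
  define w where "w = det (V + U)"
  have u0: "0 < u" and uw: "u \<le> w" and w1: "1 \<le> w" unfolding u_def w_def using assms by auto
  have jdef: "j = nat \<lfloor>log 2 w\<rfloor>" unfolding j_def w_def ..
  have j: "real j \<le> log 2 w" "log 2 w < real j + 1" "2 ^ j \<le> w" "w < 2 * 2 ^ j"
    unfolding jdef using floor_log2_bounds[OF w1] by auto
  have loglog: "ln (real j + 1) \<le> ln (log 2 w + 1)" using j(1) by simp
  have "ln (2 ^ j / u) \<le> ln (w / u)" using j(3) u0 w1 by (simp add: divide_right_mono)
  \<comment> \<open>Since \<open>u \<le> w\<close>, the truncation at \<open>0\<close> in
    \<open>grid_D\<close> stays below the true value.\<close>
  moreover have "0 \<le> ln (w / u)" using uw u0 by simp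
  ultimately have *: "max 0 (1/2 * ln (2 ^ j / u)) \<le> 1/2 * ln (w / u)" by simp
  show "1/2 * ln (det (V + U) / det U) + 1.5 + 2 * ln (real j + 1) + ln (1 / \<delta>) \<le> D_term \<delta> U V"
    using loglog unfolding D_term_def w_def by simp
  show "grid_D \<delta> (det U) j \<le> D_term \<delta> U V"
    using loglog * unfolding D_term_def grid_D_def w_def u_def by simp
  have "ln (w / u) \<le> ln (2 * (2 ^ j / u))"
    using j(4) u0 w1 by (subst ln_le_cancel_iff) (auto simp: divide_right_mono)
  also have "\<dots> = ln 2 + ln (2 ^ j / u)" using u0 by (subst ln_mult) auto
  finally have 1: "1/2 * ln (w / u) \<le> 1/2 * ln 2 + max 0 (1/2 * ln (2 ^ j / u))" by simp
  have "ln (log 2 w + 1) \<le> ln (2 * (real j + 1))" using j(1,2) by (subst ln_le_cancel_iff) auto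
  also have "\<dots> = ln 2 + ln (real j + 1)" by (subst ln_mult) auto
  finally have 2: "2 * ln (log 2 w + 1) \<le> 2 * ln 2 + 2 * ln (real j + 1)" by simp
  \<comment> \<open>Rounding costs \<open>ln 2 / 2\<close> in the determinant term and
    \<open>2 * ln 2\<close> in the iterated logarithm. The total is below \<open>2.5\<close>, the
    lower bound of \<open>grid_D\<close> given by \<open>1.5\<close> and
    \<open>ln (1 / \<delta>) \<ge> 1\<close>, so doubling absorbs it.\<close>
  have "D_term \<delta> U V \<le> 2.5 * ln 2 + grid_D \<delta> (det U) j"
    using 1 2 unfolding D_term_def grid_D_def w_def u_def by simp
  also have "2.5 * ln 2 \<le> (2.5 :: real)" using ln_2_less_1 by simp
  also have "2.5 \<le> grid_D \<delta> (det U) j" by (rule grid_D_pos[OF \<delta>])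
  finally show "D_term \<delta> U V \<le> 2 * grid_D \<delta> (det U) j" by simp
qed

section \<open>Measurability of matrix functionals\<close>

lemma borel_measurable_matrix_vector_mult [measurable]:
  fixes A :: "'a \<Rightarrow> real^'n^'m"
  assumes [measurable]: "A \<in> borel_measurable N" "x \<in> borel_measurable N"
  shows "(\<lambda>\<omega>. A \<omega> *v x \<omega>) \<in> borel_measurable N"
proof -
  have "continuous_on UNIV (\<lambda>p :: (real^'n^'m) \<times> (real^'n). fst p *v snd p)"
    unfolding matrix_vector_mult_def by (intro continuous_intros)
  then show ?thesis
    by (intro borel_measurable_continuous_Pair[of A N x "\<lambda>A x. A *v x"]) (auto simp: case_prod_beta)
qed

lemma borel_measurable_det [measurable]:
  fixes A :: "'a \<Rightarrow> real^'d^'d"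
  assumes [measurable]: "A \<in> borel_measurable N"
  shows "(\<lambda>\<omega>. det (A \<omega>)) \<in> borel_measurable N"
proof -
  have "continuous_on UNIV (det :: real^'d^'d \<Rightarrow> real)"
    unfolding det_def by (intro continuous_intros)
  then show ?thesis
    using assms by (rule borel_measurable_continuous_on)
qed

text \<open>The set where the inequality fails is open, so if nonempty it meets a countable dense
  set. One \<open>D\<close> must serve all pairs of functions, because in the measurability proofs
  they vary with \<open>\<omega>\<close>.\<close>

lemma countable_dense_le:
  obtains D :: "'b::second_countable_topology set"
  where "countable D"
    and "\<And>f g :: 'b \<Rightarrow> real. continuous_on UNIV f \<Longrightarrow> continuous_on UNIV g \<Longrightarrow>
      (\<forall>x. f x \<le> g x) \<longleftrightarrow> (\<forall>x\<in>D. f x \<le> g x)"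
proof -
  obtain D :: "'b set" where D: "countable D" "\<And>X. open X \<Longrightarrow> X \<noteq> {} \<Longrightarrow> \<exists>d\<in>D. d \<in> X"
    using countable_dense_setE by blast
  have "(\<forall>x. f x \<le> g x) \<longleftrightarrow> (\<forall>x\<in>D. f x \<le> g x)"
    if f: "continuous_on UNIV f" and g: "continuous_on UNIV g" for f g :: "'b \<Rightarrow> real"
  proof -
    have "open {x. g x < f x}"
      using f g by (intro open_Collect_less)
    then show ?thesis using D(2)[of "{x. g x < f x}"] by (force simp: not_less)
  qed
  with D(1) that show ?thesis by blast
qed

lemma borel_measurable_gamma_min:
  fixes W :: "'a \<Rightarrow> real^'d^'d"
  assumes [measurable]: "W \<in> borel_measurable N"
    and sym: "\<And>\<omega>. \<omega> \<in> space N \<Longrightarrow> transpose (W \<omega>) = W \<omega>"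
  shows "(\<lambda>\<omega>. gamma_min (W \<omega>)) \<in> borel_measurable N"
  unfolding borel_measurable_iff_ge
proof
  fix a
  obtain D :: "(real^'d) set" where D: "countable D"
    and dense: "\<And>f g :: real^'d \<Rightarrow> real. continuous_on UNIV f \<Longrightarrow> continuous_on UNIV g \<Longrightarrow>
      (\<forall>x. f x \<le> g x) \<longleftrightarrow> (\<forall>x\<in>D. f x \<le> g x)"
    by (rule countable_dense_le) blast
  have "a \<le> gamma_min (W \<omega>) \<longleftrightarrow> (\<forall>x\<in>D. a * (norm x)\<^sup>2 \<le> x \<bullet> (W \<omega> *v x))" if "\<omega> \<in> space N" for \<omega>
    unfolding le_gamma_min_iff[OF sym[OF that]]
    by (rule dense) (intro continuous_intros matrix_vector_mult_linear_continuous_on)+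
  then have "{\<omega> \<in> space N. a \<le> gamma_min (W \<omega>)} =
      {\<omega> \<in> space N. \<forall>x\<in>D. a * (norm x)\<^sup>2 \<le> x \<bullet> (W \<omega> *v x)}" by blast
  also have "\<dots> \<in> sets N"
    using D by (intro sets.sets_Collect_countable_All') measurable
  finally show "{\<omega> \<in> space N. a \<le> gamma_min (W \<omega>)} \<in> sets N" .
qed

lemma pos_def_matrix_inv:
  fixes W :: "real^'d^'d"
  assumes "pos_def W"
  shows "W *v (matrix_inv W *v s) = s"
proof -
  have "invertible W"
    using det_pos_def[OF assms] by (simp add: invertible_det_nz)
  then have "W ** matrix_inv W = mat 1"
    unfolding invertible_def matrix_inv_def by (metis (mono_tags, lifting) someI_ex)
  then show ?thesis by (simp add: matrix_vector_mul_assoc)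
qed

text \<open>Fenchel duality: the inverse form is the supremum of
  \<open>2 * (x \<bullet> s) - x \<bullet> (W *v x)\<close>, attained at \<open>y\<close>. This
  gives measurability of the norm without studying \<open>matrix_inv\<close> as a function of the
  matrix.\<close>

lemma inverse_quadratic_form_le_iff:
  fixes W :: "real^'d^'d"
  assumes W: "pos_def W"
  shows "s \<bullet> (matrix_inv W *v s) \<le> b \<longleftrightarrow> (\<forall>x. 2 * (x \<bullet> s) - x \<bullet> (W *v x) \<le> b)"
proof -
  define y where "y = matrix_inv W *v s"
  have Wy: "W *v y = s" unfolding y_def by (rule pos_def_matrix_inv[OF W])
  have sym: "transpose W = W" using W by (simp add: pos_def_def)
  have "2 * (x \<bullet> s) - x \<bullet> (W *v x) \<le> s \<bullet> y" for x
  proof -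
    have "0 \<le> (y + - x) \<bullet> (W *v (y + - x))"
      using W unfolding pos_def_def by (cases "y + - x = 0") (auto simp: less_imp_le)
    also have "\<dots> = y \<bullet> s - 2 * (x \<bullet> s) + x \<bullet> (W *v x)"
      unfolding quadratic_form_add[OF sym] Wy
      using matrix_vector_mult_scaleR[of W "- 1" x] by simp
    finally show ?thesis by (simp add: inner_commute)
  qed
  moreover have "2 * (y \<bullet> s) - y \<bullet> (W *v y) = s \<bullet> y"
    unfolding Wy by (simp add: inner_commute)
  ultimately show ?thesis unfolding y_def[symmetric] by (metis order_trans)
qed

lemma borel_measurable_mat_norm_inv:
  fixes W :: "'a \<Rightarrow> real^'d^'d"
  assumes [measurable]: "W \<in> borel_measurable N" "s \<in> borel_measurable N"
    and W: "\<And>\<omega>. \<omega> \<in> space N \<Longrightarrow> pos_def (W \<omega>)"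
  shows "(\<lambda>\<omega>. mat_norm (matrix_inv (W \<omega>)) (s \<omega>)) \<in> borel_measurable N"
proof -
  have "(\<lambda>\<omega>. s \<omega> \<bullet> (matrix_inv (W \<omega>) *v s \<omega>)) \<in> borel_measurable N"
    unfolding borel_measurable_iff_le
  proof
    fix b
    obtain D :: "(real^'d) set" where D: "countable D"
      and dense: "\<And>f g :: real^'d \<Rightarrow> real. continuous_on UNIV f \<Longrightarrow> continuous_on UNIV g \<Longrightarrow>
        (\<forall>x. f x \<le> g x) \<longleftrightarrow> (\<forall>x\<in>D. f x \<le> g x)"
      by (rule countable_dense_le) blast
    have "s \<omega> \<bullet> (matrix_inv (W \<omega>) *v s \<omega>) \<le> b \<longleftrightarrow>
        (\<forall>x\<in>D. 2 * (x \<bullet> s \<omega>) - x \<bullet> (W \<omega> *v x) \<le> b)" if "\<omega> \<in> space N" for \<omega>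
      unfolding inverse_quadratic_form_le_iff[OF W[OF that]]
      by (rule dense) (intro continuous_intros matrix_vector_mult_linear_continuous_on)+
    then have "{\<omega> \<in> space N. s \<omega> \<bullet> (matrix_inv (W \<omega>) *v s \<omega>) \<le> b} =
        {\<omega> \<in> space N. \<forall>x\<in>D. 2 * (x \<bullet> s \<omega>) - x \<bullet> (W \<omega> *v x) \<le> b}" by blast
    also have "\<dots> \<in> sets N"
      using D by (intro sets.sets_Collect_countable_All') measurable
    finally show "{\<omega> \<in> space N. s \<omega> \<bullet> (matrix_inv (W \<omega>) *v s \<omega>) \<le> b} \<in> sets N" .
  qed
  then show ?thesis unfolding mat_norm_def by measurable
qed

lemma borel_measurable_bound_rhs:
  fixes V :: "'a \<Rightarrow> real^'d^'d"
  assumes V[measurable]: "V \<in> borel_measurable N"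
    and sym: "\<And>\<omega>. \<omega> \<in> space N \<Longrightarrow> transpose (V \<omega> + U0) = V \<omega> + U0"
  shows "(\<lambda>\<omega>. bound_rhs c \<delta> U0 (V \<omega>)) \<in> borel_measurable N"
proof -
  have [measurable]: "(\<lambda>\<omega>. gamma_min (V \<omega> + U0)) \<in> borel_measurable N"
    by (rule borel_measurable_gamma_min) (use sym in auto)
  have [measurable]: "(\<lambda>\<omega>. D_term \<delta> U0 (V \<omega>)) \<in> borel_measurable N"
    unfolding D_term_def log_def by measurable
  have [measurable]: "(\<lambda>\<omega>. H_term c U0 (V \<omega>)) \<in> borel_measurable N"
    unfolding H_term_def by measurable
  show ?thesis unfolding bound_rhs_def Let_def by measurable
qed

section \<open>Self-normalized bound\<close>

lemma pos_def_add:
  assumes "pos_def A" "pos_def B"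
  shows "pos_def (A + B)"
proof -
  have "transpose (A + B) = transpose A + transpose B"
    by (simp add: transpose_def vec_eq_iff)
  then show ?thesis using assms unfolding pos_def_def
    by (auto simp: matrix_vector_mult_add_rdistrib inner_simps add_pos_pos)
qed

lemma loewner_ge_quadratic_form:
  assumes "loewner_ge A B"
  shows "x \<bullet> (B *v x) \<le> x \<bullet> (A *v x)"
  using assms unfolding loewner_ge_def pos_semidef_def
  by (simp add: matrix_vector_mult_diff_rdistrib inner_simps)

text \<open>The deterministic half, for one time and one outcome. While the mixture of level
  \<open>j\<close> stays below its threshold, inserting \<open>m\<close> on the ray of
  \<open>matrix_inv W *v s\<close> into the lower bound and taking logarithms gives
  \<open>b * n \<le> a / 2 * b\<^sup>2 + D\<close>. For \<open>H = 0\<close> the bound is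
  infinite.\<close>

lemma bound_of_truncated_mixture:
  fixes U V :: "real^'d^'d" and s :: "real^'d"
  assumes c: "0 < c" and \<delta>: "0 < \<delta>" "\<delta> \<le> 1 / exp 1"
    and U: "pos_def U" and V: "pos_def V" and ge: "loewner_ge (V + U) (mat 1)"
  defines "j \<equiv> nat \<lfloor>log 2 (det (V + U))\<rfloor>"
  defines "r \<equiv> xi c (1 / grid_D \<delta> (det U) j)"
  assumes mix: "\<not> truncated_mixture (1 / (1 - c * r)) r U 0 * ennreal (exp 1.5 * (real j + 1)\<^sup>2 / \<delta>)
      \<le> truncated_mixture (1 / (1 - c * r)) r (V + U) s"
  shows "ereal (mat_norm (matrix_inv (V + U)) s) \<le> bound_rhs c \<delta> U V"
proof (cases "H_term c U V = 0")
  case False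
  define W where "W = V + U"
  define n where "n = mat_norm (matrix_inv W) s"
  define \<rho> where "\<rho> = sqrt (gamma_max U / gamma_min W)"
  define a where "a = 1 / (1 - c * r)"
  \<comment> \<open>The part of the radius left free by the operator bound \<open>\<rho>\<close> of
    the congruence; \<open>m\<close> gets this length in the \<open>W\<close>-norm.\<close>
  define b where "b = (1 - \<rho>) * r"
  have W: "pos_def W" unfolding W_def by (rule pos_def_add[OF V U])
  have symW: "transpose W = W" and symU: "transpose U = U"
    using W U by (auto simp: pos_def_def)
  have gmin: "1 \<le> gamma_min W"
    using loewner_ge_quadratic_form[OF ge, folded W_def]
    by (simp add: le_gamma_min_iff[OF symW] power2_norm_eq_inner)
  have gmax: "0 \<le> gamma_max U"
  proof -
    have "0 < (1 :: real^'d) \<bullet> (U *v 1)" using U unfolding pos_def_def by simp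
    also have "\<dots> \<le> gamma_max U * (norm (1 :: real^'d))\<^sup>2" by (rule gamma_max_quadratic_form[OF symU])
    finally show ?thesis by (simp add: zero_less_mult_iff)
  qed
  have q: "0 \<le> gamma_max U / gamma_min (V + U)"
    using gmin gmax unfolding W_def by simp
  have H: "0 < H_term c U V" "H_term c U V \<le> (1 - \<rho>) / 2" and rho: "0 \<le> \<rho>" "\<rho> < 1"
    using H_term_le[OF c q False] q unfolding \<rho>_def W_def by auto
  have detU: "0 < det U" and detW: "0 < det W" using det_pos_def U W by auto
  have UW: "det U \<le> det W"
  proof (rule det_mono_pos_def[OF U W])
    fix x
    show "x \<bullet> (U *v x) \<le> x \<bullet> (W *v x)"
      using V unfolding W_def pos_def_def matrix_vector_mult_add_rdistrib inner_add_right
      by (cases "x = 0") (auto simp: less_imp_le)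
  qed
  \<comment> \<open>Comparison with the identity gives \<open>1 \<le> det W\<close>, so the dyadic
    level is well defined.\<close>
  have "pos_def (mat 1 :: real^'d^'d)" unfolding pos_def_def by simp
  from det_mono_pos_def[OF this W] have W1: "1 \<le> det W"
    using loewner_ge_quadratic_form[OF ge] unfolding W_def by simp
  define D where "D = D_term \<delta> U V"
  define D' where "D' = grid_D \<delta> (det U) j"
  have D: "D' \<le> D" "D \<le> 2 * D'"
    and Dj: "1/2 * ln (det W / det U) + 1.5 + 2 * ln (real j + 1) + ln (1 / \<delta>) \<le> D"
    using grid_D_bounds[OF \<delta> detU] UW W1 unfolding D_def D'_def j_def W_def by auto
  have D'0: "0 < D'" using grid_D_pos[OF \<delta>, of "det U" j] unfolding D'_def by simp
  have r: "0 < r" unfolding r_def using c D'0 by (intro xi_pos) (auto simp: D'_def)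
  have cr: "c * r < 1" unfolding r_def D'_def[symmetric] by (rule xi_less[OF c D'0])
  have a: "0 < a" unfolding a_def using cr by simp
  have b: "0 < b" unfolding b_def using r rho by simp
  define y where "y = matrix_inv W *v s"
  have Wy: "W *v y = s" unfolding y_def by (rule pos_def_matrix_inv[OF W])
  have ys: "0 \<le> y \<bullet> s"
    using W unfolding pos_def_def Wy[symmetric] by (cases "y = 0") (auto simp: less_imp_le)
  have n: "n = sqrt (y \<bullet> s)" unfolding n_def mat_norm_def y_def[symmetric] by (simp add: inner_commute)
  have main: "b * n \<le> a / 2 * b\<^sup>2 + D"
  proof (cases "n = 0")
    case True
    then show ?thesis using a D D'0 by simp
  next
    case False
    then have n0: "0 < n" using n ys by simp
    have n2: "n\<^sup>2 = y \<bullet> s" using n ys by simp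
    \<comment> \<open>Among vectors of \<open>W\<close>-norm \<open>b\<close>, this one maximizes
      the pairing with \<open>s\<close>, by Cauchy-Schwarz.\<close>
    define m where "m = (b / n) *\<^sub>R y"
    have ms: "m \<bullet> s = b * n"
      unfolding m_def using n0 by (simp add: n2[symmetric] power2_eq_square)
    have mW: "m \<bullet> (W *v m) = b\<^sup>2"
      unfolding m_def quadratic_form_scaleR Wy n2[symmetric] using n0 by (simp add: power_divide)
    \<comment> \<open>\<open>W\<close> dominates the identity, so Euclidean length is at most
      \<open>W\<close>-length.\<close>
    have "(norm m)\<^sup>2 \<le> gamma_min W * (norm m)\<^sup>2" using gmin by (simp add: mult_le_cancel_right1)
    also have "\<dots> \<le> b\<^sup>2" using gamma_min_quadratic_form[OF symW, of m] mW by simp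
    finally have "norm m \<le> b" by (rule power2_le_imp_le) (use b in simp)
    then have "norm m + sqrt (gamma_max U / gamma_min W) * r \<le> r"
      unfolding b_def \<rho>_def[symmetric] by (simp add: algebra_simps)
    from truncated_mixture_lower_bound[OF U W less_imp_le[OF r] this, of s a]
    have "ennreal (sqrt (det U / det W) * exp (b * n - a / 2 * b\<^sup>2)) * truncated_mixture a r U 0
        \<le> truncated_mixture a r W s"
      unfolding ms mW .
    also have "\<dots> < truncated_mixture a r U 0 * ennreal (exp 1.5 * (real j + 1)\<^sup>2 / \<delta>)"
      using mix unfolding a_def W_def by simp
    \<comment> \<open>The normalizing constant cancels by monotonicity: the reverse inequality,
      multiplied by it, would contradict strictness.\<close>
    finally have "ennreal (sqrt (det U / det W) * exp (b * n - a / 2 * b\<^sup>2))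
        < ennreal (exp 1.5 * (real j + 1)\<^sup>2 / \<delta>)"
      by (metis mult.commute mult_left_mono not_le zero_le)
    then have lt: "sqrt (det U / det W) * exp (b * n - a / 2 * b\<^sup>2) < exp 1.5 * (real j + 1)\<^sup>2 / \<delta>"
      using detU detW \<delta> by (subst (asm) ennreal_less_iff) auto
    have "ln (sqrt (det U / det W) * exp (b * n - a / 2 * b\<^sup>2)) < ln (exp 1.5 * (real j + 1)\<^sup>2 / \<delta>)"
      using lt detU detW \<delta> by (subst ln_less_cancel_iff) auto
    also have "ln (sqrt (det U / det W) * exp (b * n - a / 2 * b\<^sup>2)) =
        - (1/2 * ln (det W / det U)) + (b * n - a / 2 * b\<^sup>2)"
      using detU detW by (simp add: ln_mult ln_sqrt ln_div field_simps)
    also have "ln (exp 1.5 * (real j + 1)\<^sup>2 / \<delta>) = 1.5 + 2 * ln (real j + 1) + ln (1 / \<delta>)"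
      using \<delta> by (simp add: ln_mult ln_div ln_realpow)
    finally show ?thesis using Dj by linarith
  qed
  have "n \<le> (c * D + 1.51 * sqrt D + xi c c * max (1 / (xi c (gamma_min U) * gamma_min U)) (sqrt (D / 2)))
      / H_term c U V"
    using main D'0 D rho H unfolding b_def a_def r_def D'_def[symmetric]
    by (intro optimized_radius_bound[OF c D'0 D rho H])
  then show ?thesis
    using False unfolding bound_rhs_def Let_def n_def W_def D_def by simp
qed (simp add: bound_rhs_def)

text \<open>Polar coordinates reduce \<open>x\<close> to a direction \<open>u\<close> and a scale
  \<open>l = norm x\<close>. For \<open>l \<le> r\<close> the denominator in \<open>psi_G\<close> is
  at least \<open>2 * (1 - c * r)\<close>, so the quadratic exponent lies below the one dominated by
  \<open>L\<close>.\<close>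

lemma (in filtered_prob_space) sub_psi_sum_disjoint_le:
  fixes S :: "nat \<Rightarrow> 'a \<Rightarrow> real^'d" and V :: "nat \<Rightarrow> 'a \<Rightarrow> real^'d^'d"
  assumes c: "0 < c" and sub: "sub_psi_process M F (1 / c) (psi_G c) S V"
    and r: "norm x \<le> r" "c * r < 1"
    and A: "\<And>k. A k \<in> sets (F k)" and disj: "disjoint_family A"
  shows "(\<Sum>k\<le>n. \<integral>\<^sup>+\<omega>. ennreal (exp (x \<bullet> S k \<omega> - 1 / (1 - c * r) / 2 * (x \<bullet> (V k \<omega> *v x))))
      * indicator (A k) \<omega> \<partial>M) \<le> 1"
proof -
  obtain u :: "real^'d" where u: "norm u = 1" "x = norm x *\<^sub>R u"
  proof (cases "x = 0")
    case True
    \<comment> \<open>At \<open>x = 0\<close> any direction works, since the scale is the admissible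
      value \<open>0\<close>.\<close>
    show ?thesis by (rule that[of "axis undefined 1"]) (simp_all add: True norm_axis_1)
  next
    case False
    then show ?thesis by (intro that[of "(1 / norm x) *\<^sub>R x"]) auto
  qed
  define l where "l = norm x"
  have cl: "c * l \<le> c * r" using c r unfolding l_def by simp
  then have "c * l < 1" using r by linarith
  then have l: "l \<in> {0..<1 / c}" using c unfolding l_def by (simp add: field_simps)
  obtain L where L: "supermartingale M F L" "\<And>t. AE \<omega> in M. 0 \<le> L t \<omega>" "AE \<omega> in M. L 0 \<omega> \<le> 1"
    and dom: "\<And>t. AE \<omega> in M. exp (l * (u \<bullet> S t \<omega>) - psi_G c l * (u \<bullet> (V t \<omega> *v u))) \<le> L t \<omega>"
    using sub u(1) l unfolding sub_psi_process_def by meson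
  have pd: "pos_def (V t \<omega>)" if "\<omega> \<in> space M" for t \<omega>
    using sub that unfolding sub_psi_process_def by blast
  have psi: "psi_G c l \<le> 1 / (1 - c * r) / 2 * l\<^sup>2"
  proof -
    have "l\<^sup>2 / (2 * (1 - c * l)) \<le> l\<^sup>2 / (2 * (1 - c * r))"
      using cl r by (intro divide_left_mono mult_pos_pos) auto
    then show ?thesis unfolding psi_G_def by (simp add: mult.commute)
  qed
  have "AE \<omega> in M. exp (x \<bullet> S t \<omega> - 1 / (1 - c * r) / 2 * (x \<bullet> (V t \<omega> *v x))) \<le> L t \<omega>" for t
    using dom[of t] AE_space
  proof eventually_elim
    case (elim \<omega>)
    have "0 \<le> u \<bullet> (V t \<omega> *v u)"
      using pd[OF elim(2), of t] u(1) unfolding pos_def_def by (cases "u = 0") (auto simp: less_imp_le)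
    from mult_right_mono[OF psi this]
    have "x \<bullet> S t \<omega> - 1 / (1 - c * r) / 2 * (x \<bullet> (V t \<omega> *v x))
        \<le> l * (u \<bullet> S t \<omega>) - psi_G c l * (u \<bullet> (V t \<omega> *v u))"
      unfolding u(2)[folded l_def] quadratic_form_scaleR by (simp add: mult.assoc)
    then have "exp (x \<bullet> S t \<omega> - 1 / (1 - c * r) / 2 * (x \<bullet> (V t \<omega> *v x)))
        \<le> exp (l * (u \<bullet> S t \<omega>) - psi_G c l * (u \<bullet> (V t \<omega> *v u)))" by simp
    with elim(1) show ?case by (rule order_trans[rotated])
  qed
  from dominated_sum_disjoint_le[OF L this A disj] show ?thesis .
qed

text \<open>Ville's inequality for the mixture at level \<open>Z * K\<close>. Here \<open>Z\<close>
  is also the total mass of the prior \<open>g\<close>, so it cancels and leaves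
  \<open>1 / K\<close>.\<close>

lemma (in filtered_prob_space) truncated_mixture_exceedance:
  fixes S :: "nat \<Rightarrow> 'a \<Rightarrow> real^'d" and V :: "nat \<Rightarrow> 'a \<Rightarrow> real^'d^'d" and U :: "real^'d^'d"
  assumes c: "0 < c" and sub: "sub_psi_process M F (1 / c) (psi_G c) S V"
    and U: "pos_def U" and r: "0 < r" "c * r < 1" and K: "0 < K"
  defines "a \<equiv> 1 / (1 - c * r)"
  defines "B \<equiv> {\<omega>\<in>space M. \<exists>k. truncated_mixture a r U 0 * ennreal K
      \<le> truncated_mixture a r (V k \<omega> + U) (S k \<omega>)}"
  shows "B \<in> sets M" "measure M B \<le> 1 / K"
proof -
  have a: "0 \<le> a" unfolding a_def using r by simp
  define X where "X k \<omega> x = indicator (cball 0 r) x *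
      ennreal (exp (x \<bullet> S k \<omega> - a / 2 * (x \<bullet> ((V k \<omega> + U) *v x))))" for k \<omega> x
  define g where "g x = indicator (cball 0 r) x *
      ennreal (exp (x \<bullet> (0 :: real^'d) - a / 2 * (x \<bullet> (U *v x))))" for x
  have SF: "S k \<in> borel_measurable (F k)" and VF: "V k \<in> borel_measurable (F k)" for k
    using sub unfolding sub_psi_process_def adapted_def by auto
  have cb[measurable]: "cball (0::real^'d) r \<in> sets borel" by simp
  have X: "(\<lambda>(\<omega>, x). X k \<omega> x) \<in> borel_measurable (F k \<Otimes>\<^sub>M lborel)" for k
  proof -
    note [measurable] = SF[of k] VF[of k]
    show ?thesis unfolding X_def by measurable
  qed
  have g: "g \<in> borel_measurable lborel" unfolding g_def by measurable
  have le: "(\<Sum>k\<le>n. \<integral>\<^sup>+\<omega>. X k \<omega> x * indicator (A k) \<omega> \<partial>M) \<le> g x"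
    if A: "\<And>k. A k \<in> sets (F k)" and disj: "disjoint_family A" for x A n
  proof (cases "norm x \<le> r")
    case True
    \<comment> \<open>Splitting \<open>V + U\<close> separates the prior factor, constant in
      \<open>\<omega>\<close>, from the process bounded for this fixed \<open>x\<close>.\<close>
    have X_eq: "X k \<omega> x = g x * ennreal (exp (x \<bullet> S k \<omega> - a / 2 * (x \<bullet> (V k \<omega> *v x))))" for k \<omega>
      unfolding X_def g_def using True
      by (simp add: ennreal_mult[symmetric] exp_add[symmetric] matrix_vector_mult_add_rdistrib
          inner_simps algebra_simps)
    have meas: "(\<lambda>\<omega>. ennreal (exp (x \<bullet> S k \<omega> - a / 2 * (x \<bullet> (V k \<omega> *v x)))) * indicator (A k) \<omega>)
        \<in> borel_measurable M" for k
    proof -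
      note [measurable] = measurable_from_subalg[OF subalgebra_F SF[of k]]
        measurable_from_subalg[OF subalgebra_F VF[of k]] sets_F_M[OF A[of k]]
      show ?thesis by measurable
    qed
    have "(\<Sum>k\<le>n. \<integral>\<^sup>+\<omega>. X k \<omega> x * indicator (A k) \<omega> \<partial>M) = g x *
        (\<Sum>k\<le>n. \<integral>\<^sup>+\<omega>. ennreal (exp (x \<bullet> S k \<omega> - a / 2 * (x \<bullet> (V k \<omega> *v x)))) * indicator (A k) \<omega> \<partial>M)"
      unfolding X_eq mult.assoc sum_distrib_left by (intro sum.cong refl nn_integral_cmult meas)
    also have "\<dots> \<le> g x * 1"
      unfolding a_def using sub_psi_sum_disjoint_le[OF c sub True r(2) A disj] by (intro mult_left_mono) auto
    finally show ?thesis by simp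
  qed (simp add: X_def)
  define Z where "Z = truncated_mixture a r U 0"
  have Z: "Z = (\<integral>\<^sup>+x. g x \<partial>lborel)"
    unfolding Z_def truncated_mixture_def g_def by simp
  have B: "B = {\<omega>\<in>space M. \<exists>k. Z * ennreal K \<le> (\<integral>\<^sup>+x. X k \<omega> x \<partial>lborel)}"
    unfolding B_def Z_def truncated_mixture_def X_def ..
  note ville = ville_mixture[OF lborel.sigma_finite_measure_axioms X g le, of "Z * ennreal K", folded B Z]
  show "B \<in> sets M" using ville(1) .
  obtain z where z: "Z = ennreal z" "0 < z"
    using truncated_mixture_0_bounds[OF U a r(1)] unfolding Z_def[symmetric]
    by (cases Z) (auto simp: ennreal_less_zero_iff)
  have "ennreal (z * K * measure M B) = Z * ennreal K * emeasure M B"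
    unfolding z(1) emeasure_eq_measure using z(2) K by (simp add: ennreal_mult less_imp_le)
  also have "\<dots> \<le> ennreal z" using ville(2) unfolding z(1) .
  finally have "z * K * measure M B \<le> z" using z(2) by (subst (asm) ennreal_le_iff) auto
  then have "K * measure M B \<le> 1" using z(2) by (simp add: mult.assoc)
  then show "measure M B \<le> 1 / K" using K by (simp add: pos_le_divide_eq mult.commute)
qed

text \<open>The source of the constant \<open>1.5\<close> in \<open>D_term\<close>: the Basel sum
  \<open>pi\<^sup>2 / 6\<close> is below \<open>exp 1.5\<close>, so the bad events of all levels
  together have probability at most \<open>\<delta>\<close>.\<close>

lemma sum_grid_weights_le:
  assumes \<delta>: "0 < \<delta>"
  shows "summable (\<lambda>j. 1 / (exp 1.5 * (real j + 1)\<^sup>2 / \<delta>))"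
    and "(\<Sum>j. 1 / (exp 1.5 * (real j + 1)\<^sup>2 / \<delta>)) \<le> \<delta>"
proof -
  have "(\<lambda>j. \<delta> / exp 1.5 * (1 / (real j + 1)\<^sup>2)) sums (\<delta> / exp 1.5 * (pi\<^sup>2 / 6))"
    using inverse_squares_sums by (intro sums_mult) (simp add: add.commute)
  then have sums: "(\<lambda>j. 1 / (exp 1.5 * (real j + 1)\<^sup>2 / \<delta>)) sums (\<delta> / exp 1.5 * (pi\<^sup>2 / 6))"
    by simp
  then show "summable (\<lambda>j. 1 / (exp 1.5 * (real j + 1)\<^sup>2 / \<delta>))" by (rule sums_summable)
  \<comment> \<open>Crude bounds suffice: \<open>16 / 6 < 1 + 1.5 + 1.5\<^sup>2 / 2\<close>.\<close>
  have "pi\<^sup>2 \<le> 4\<^sup>2" using pi_less_4 by (intro power_mono) auto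
  moreover have "1 + 1.5 + 1.5\<^sup>2 / 2 \<le> exp (1.5 :: real)"
    by (rule exp_lower_Taylor_quadratic) simp
  ultimately have "pi\<^sup>2 / 6 \<le> exp 1.5" by (simp add: power2_eq_square)
  then have "\<delta> / exp 1.5 * (pi\<^sup>2 / 6) \<le> \<delta>" using \<delta> by (simp add: field_simps)
  with sums show "(\<Sum>j. 1 / (exp 1.5 * (real j + 1)\<^sup>2 / \<delta>)) \<le> \<delta>"
    by (simp add: sums_iff)
qed

theorem theorem4p4:
  fixes M :: "'a measure" and F :: "nat \<Rightarrow> 'a measure"
    and S :: "nat \<Rightarrow> 'a \<Rightarrow> real^'d" and V :: "nat \<Rightarrow> 'a \<Rightarrow> real^'d^'d"
    and U0 :: "real^'d^'d" and c \<delta> :: real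
  assumes "filtered_prob_space M F"
    and "0 < c"
    and "sub_psi_process M F (1 / c) (psi_G c) S V"
    and "pos_def U0"
    and "\<forall>t\<ge>1. AE \<omega> in M. loewner_ge (V t \<omega> + U0) (mat 1)"
    and "0 < \<delta>" and "\<delta> \<le> 1 / exp 1"
  shows "measure M {\<omega>\<in>space M. \<forall>\<tau>. stopping_time F \<tau> \<longrightarrow> 1 \<le> \<tau> \<omega> \<longrightarrow>
           ereal (mat_norm (matrix_inv (V (\<tau> \<omega>) \<omega> + U0)) (S (\<tau> \<omega>) \<omega>))
             \<le> bound_rhs c \<delta> U0 (V (\<tau> \<omega>) \<omega>)} \<ge> 1 - \<delta>"
proof -
  interpret filtered_prob_space M F by fact
  define Q where "Q t \<omega> \<longleftrightarrow> ereal (mat_norm (matrix_inv (V t \<omega> + U0)) (S t \<omega>))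
      \<le> bound_rhs c \<delta> U0 (V t \<omega>)" for t \<omega>
  define G where "G = {\<omega>\<in>space M. \<forall>t\<ge>1. Q t \<omega>}"
  \<comment> \<open>Each dyadic level \<open>j\<close> of the determinant gets a deterministic
    radius, a threshold and a bad event.\<close>
  define r where "r j = xi c (1 / grid_D \<delta> (det U0) j)" for j
  define K where "K j = exp 1.5 * (real j + 1)\<^sup>2 / \<delta>" for j
  define B where "B j = {\<omega>\<in>space M. \<exists>k. truncated_mixture (1 / (1 - c * r j)) (r j) U0 0 * ennreal (K j)
      \<le> truncated_mixture (1 / (1 - c * r j)) (r j) (V k \<omega> + U0) (S k \<omega>)}" for j
  have V: "pos_def (V t \<omega>)" if "\<omega> \<in> space M" for t \<omega>
    using assms(3) that unfolding sub_psi_process_def by blast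
  have VU: "pos_def (V t \<omega> + U0)" if "\<omega> \<in> space M" for t \<omega>
    using V[OF that] assms(4) by (rule pos_def_add)
  have meas[measurable]: "S t \<in> borel_measurable M" "V t \<in> borel_measurable M" for t
    using assms(3) measurable_from_subalg[OF subalgebra_F[of t]]
    unfolding sub_psi_process_def adapted_def by auto
  \<comment> \<open>\<open>measure\<close> returns \<open>0\<close> on nonmeasurable sets, so the
    event must be shown measurable.\<close>
  have Q_sets: "{\<omega>\<in>space M. Q t \<omega>} \<in> sets M" for t
  proof -
    have [measurable]: "(\<lambda>\<omega>. mat_norm (matrix_inv (V t \<omega> + U0)) (S t \<omega>)) \<in> borel_measurable M"
      by (rule borel_measurable_mat_norm_inv) (use VU in auto)
    have [measurable]: "(\<lambda>\<omega>. bound_rhs c \<delta> U0 (V t \<omega>)) \<in> borel_measurable M"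
      by (rule borel_measurable_bound_rhs) (use VU in \<open>auto simp: pos_def_def\<close>)
    show ?thesis unfolding Q_def by measurable
  qed
  have G_sets: "G \<in> sets M"
    unfolding G_def using Q_sets by (intro sets.sets_Collect)
  have grid: "0 < grid_D \<delta> (det U0) j" for j
    using grid_D_pos[OF assms(6,7), of "det U0" j] by simp
  have rpos: "0 < r j" and cr: "c * r j < 1" and Kpos: "0 < K j" for j
    unfolding r_def K_def using xi_pos[OF assms(2), of "1 / grid_D \<delta> (det U0) j"] grid[of j]
      xi_less[OF assms(2) grid[of j]] assms(6) by auto
  have B: "B j \<in> sets M" "measure M (B j) \<le> 1 / K j" for j
    unfolding B_def
    using truncated_mixture_exceedance[OF assms(2-4) rpos[of j] cr[of j] Kpos[of j]] by auto
  have summK: "summable (\<lambda>j. 1 / K j)"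
    unfolding K_def by (rule sum_grid_weights_le(1)[OF assms(6)])
  have summ: "summable (\<lambda>j. measure M (B j))"
    by (rule summable_comparison_test'[OF summK, of 0]) (use B(2) in simp)
  have "measure M (\<Union>j. B j) \<le> (\<Sum>j. measure M (B j))"
    using B(1) by (intro finite_measure_subadditive_countably summ) auto
  also have "\<dots> \<le> (\<Sum>j. 1 / K j)"
    by (intro suminf_le summ summK B(2))
  also have "\<dots> \<le> \<delta>"
    unfolding K_def by (rule sum_grid_weights_le(2)[OF assms(6)])
  finally have UB: "measure M (\<Union>j. B j) \<le> \<delta>" .
  \<comment> \<open>There are countably many times, so the null sets for the individual
    \<open>t\<close> merge into one.\<close>
  have ae: "AE \<omega> in M. \<forall>t\<ge>1. loewner_ge (V t \<omega> + U0) (mat 1)"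
    unfolding AE_all_countable using assms(5) by auto
  have "AE \<omega> in M. \<omega> \<in> space M - (\<Union>j. B j) \<longrightarrow> \<omega> \<in> G"
    using ae
  proof eventually_elim
    case (elim \<omega>)
    show ?case
    proof
      assume \<omega>: "\<omega> \<in> space M - (\<Union>j. B j)"
      have "Q t \<omega>" if "1 \<le> t" for t
      proof -
        \<comment> \<open>The level is chosen after seeing \<open>V t \<omega>\<close>, which is
          legitimate because \<open>\<omega>\<close> avoids the bad events of all levels at
          once.\<close>
        define j where "j = nat \<lfloor>log 2 (det (V t \<omega> + U0))\<rfloor>"
        have "\<not> truncated_mixture (1 / (1 - c * r j)) (r j) U0 0 * ennreal (K j)
            \<le> truncated_mixture (1 / (1 - c * r j)) (r j) (V t \<omega> + U0) (S t \<omega>)"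
          using \<omega> unfolding B_def by blast
        then show ?thesis
          unfolding Q_def r_def K_def j_def
          using \<omega> elim that by (intro bound_of_truncated_mixture assms(2,4,6,7) V) auto
      qed
      then show "\<omega> \<in> G" unfolding G_def using \<omega> by blast
    qed
  qed
  then have "measure M (space M - (\<Union>j. B j)) \<le> measure M G"
    using G_sets by (rule finite_measure_mono_AE)
  moreover have "measure M (space M - (\<Union>j. B j)) = 1 - measure M (\<Union>j. B j)"
    using B(1) by (intro prob_compl) auto
  ultimately have "1 - \<delta> \<le> measure M G" using UB by simp
  then show ?thesis
    unfolding G_def stopping_time_event_eq[of M F Q, symmetric] unfolding Q_def .
qed

end
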